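(* Suppose $\mathcal{M}_1,\mathcal{M}_2,\mathcal{M}_3$ are models of $\mathrm{PA}$, and for $i=1,2,3$, $\mathcal{M}_i^+$ is an $\mathcal{L}_i$-structure ($\mathcal{L}_i\supseteq\mathcal{L}_{\mathrm{A}}$) expanding $\mathcal{M}_i$ with $\mathcal{M}_i^+\models\mathrm{PA}(\mathcal{L}_i)$. If $\mathcal{M}_1^+\trianglerighteq\mathcal{M}_2^+\trianglerighteq\mathcal{M}_3^+$ and there is an $\mathcal{M}_1^+$-definable isomorphism $i_0:\mathcal{M}_1\to\mathcal{M}_3$, then there is an $\mathcal{M}_1^+$-definable isomorphism $i:\mathcal{M}_1\to\mathcal{M}_2$. Consequently, an isomorphic copy of $\mathcal{M}_2^+$ is $\omega$-interpretable in $\mathcal{M}_1^+$, where moreover the isomorphism is $\mathcal{M}_1^+$-definable.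
   Context: $\mathcal{L}_{\mathrm{A}}=\{+,\cdot,\mathrm{S},<,0\}$; $\mathrm{PA}(\mathcal{L})$ is $\mathrm{PA}$ with induction for all $\mathcal{L}$-formulae. For structures $\mathcal{N}$ and $\mathcal{M}$, $\mathcal{M}\trianglerighteq\mathcal{N}$ ($\mathcal{N}$ is interpretable in $\mathcal{M}$) means that the universe of $\mathcal{N}$ and the interpretations in $\mathcal{N}$ of all symbols of its language are definable (parameters allowed) in $\mathcal{M}$; a map between such interpreted structures is $\mathcal{M}$-definable if it is definable in $\mathcal{M}$ via these interpretations (interpretations compose). Being $\omega$-interpretable in $\mathcal{M}_1^+$ means interpretable in $\mathcal{M}_1^+$ with the same universe and the same arithmetical operations as $\mathcal{M}_1$. *)

theory Defs
  imports Main
begin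

section \<open>First-order languages and structures\<close>

text \<open>
  A symbol is a name together with its arity; equality is a logical symbol.
  Variables are de Bruijn indices.
\<close>

record ('f, 'r) lang =
  funs :: "('f \<times> nat) set"
  rels :: "('r \<times> nat) set"

definition sublang :: "('f, 'r) lang \<Rightarrow> ('f, 'r) lang \<Rightarrow> bool" where
  "sublang L L' \<longleftrightarrow> funs L \<subseteq> funs L' \<and> rels L \<subseteq> rels L'"

datatype 'f tm = Var nat | Fn 'f "'f tm list"

datatype ('f, 'r) fm =
    Eq "'f tm" "'f tm"
  | Rl 'r "'f tm list"
  | Neg "('f, 'r) fm"
  | Conj "('f, 'r) fm" "('f, 'r) fm"
  | Forall "('f, 'r) fm"

abbreviation Imp :: "('f, 'r) fm \<Rightarrow> ('f, 'r) fm \<Rightarrow> ('f, 'r) fm" where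
  "Imp \<phi> \<psi> \<equiv> Neg (Conj \<phi> (Neg \<psi>))"

abbreviation Iff :: "('f, 'r) fm \<Rightarrow> ('f, 'r) fm \<Rightarrow> ('f, 'r) fm" where
  "Iff \<phi> \<psi> \<equiv> Conj (Imp \<phi> \<psi>) (Imp \<psi> \<phi>)"

abbreviation Exists :: "('f, 'r) fm \<Rightarrow> ('f, 'r) fm" where
  "Exists \<phi> \<equiv> Neg (Forall (Neg \<phi>))"

fun tm_in :: "('f, 'r) lang \<Rightarrow> 'f tm \<Rightarrow> bool" where
  "tm_in L (Var n) \<longleftrightarrow> True"
| "tm_in L (Fn f ts) \<longleftrightarrow> (f, length ts) \<in> funs L \<and> (\<forall>t\<in>set ts. tm_in L t)"

fun fm_in :: "('f, 'r) lang \<Rightarrow> ('f, 'r) fm \<Rightarrow> bool" where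
  "fm_in L (Eq s t) \<longleftrightarrow> tm_in L s \<and> tm_in L t"
| "fm_in L (Rl r ts) \<longleftrightarrow> (r, length ts) \<in> rels L \<and> (\<forall>t\<in>set ts. tm_in L t)"
| "fm_in L (Neg \<phi>) \<longleftrightarrow> fm_in L \<phi>"
| "fm_in L (Conj \<phi> \<psi>) \<longleftrightarrow> fm_in L \<phi> \<and> fm_in L \<psi>"
| "fm_in L (Forall \<phi>) \<longleftrightarrow> fm_in L \<phi>"

fun subst_tm :: "(nat \<Rightarrow> 'f tm) \<Rightarrow> 'f tm \<Rightarrow> 'f tm" where
  "subst_tm \<sigma> (Var n) = \<sigma> n"
| "subst_tm \<sigma> (Fn f ts) = Fn f (map (subst_tm \<sigma>) ts)"

fun subst_fm :: "(nat \<Rightarrow> 'f tm) \<Rightarrow> ('f, 'r) fm \<Rightarrow> ('f, 'r) fm" where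
  "subst_fm \<sigma> (Eq s t) = Eq (subst_tm \<sigma> s) (subst_tm \<sigma> t)"
| "subst_fm \<sigma> (Rl r ts) = Rl r (map (subst_tm \<sigma>) ts)"
| "subst_fm \<sigma> (Neg \<phi>) = Neg (subst_fm \<sigma> \<phi>)"
| "subst_fm \<sigma> (Conj \<phi> \<psi>) = Conj (subst_fm \<sigma> \<phi>) (subst_fm \<sigma> \<psi>)"
| "subst_fm \<sigma> (Forall \<phi>) =
    Forall (subst_fm (case_nat (Var 0) (\<lambda>n. subst_tm (\<lambda>m. Var (Suc m)) (\<sigma> n))) \<phi>)"

record ('a, 'f, 'r) struct =
  univ :: "'a set"
  fn :: "'f \<Rightarrow> 'a list \<Rightarrow> 'a"
  rel :: "'r \<Rightarrow> 'a list \<Rightarrow> bool"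

definition tuples :: "'a set \<Rightarrow> nat \<Rightarrow> 'a list set" where
  "tuples A n = {xs. length xs = n \<and> set xs \<subseteq> A}"

definition is_struct :: "('f, 'r) lang \<Rightarrow> ('a, 'f, 'r) struct \<Rightarrow> bool" where
  "is_struct L M \<longleftrightarrow> univ M \<noteq> {} \<and>
     (\<forall>(f, n) \<in> funs L. \<forall>xs \<in> tuples (univ M) n. fn M f xs \<in> univ M)"

fun val :: "('a, 'f, 'r) struct \<Rightarrow> (nat \<Rightarrow> 'a) \<Rightarrow> 'f tm \<Rightarrow> 'a" where
  "val M e (Var n) = e n"
| "val M e (Fn f ts) = fn M f (map (val M e) ts)"

fun sat :: "('a, 'f, 'r) struct \<Rightarrow> (nat \<Rightarrow> 'a) \<Rightarrow> ('f, 'r) fm \<Rightarrow> bool" where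
  "sat M e (Eq s t) \<longleftrightarrow> val M e s = val M e t"
| "sat M e (Rl r ts) \<longleftrightarrow> rel M r (map (val M e) ts)"
| "sat M e (Neg \<phi>) \<longleftrightarrow> \<not> sat M e \<phi>"
| "sat M e (Conj \<phi> \<psi>) \<longleftrightarrow> sat M e \<phi> \<and> sat M e \<psi>"
| "sat M e (Forall \<phi>) \<longleftrightarrow> (\<forall>a \<in> univ M. sat M (case_nat a e) \<phi>)"

text \<open>Axioms may have free variables and stand for their universal closures.\<close>

definition models :: "('f, 'r) lang \<Rightarrow> ('a, 'f, 'r) struct \<Rightarrow> ('f, 'r) fm set \<Rightarrow> bool" where
  "models L M T \<longleftrightarrow> is_struct L M \<and>
     (\<forall>\<phi> \<in> T. \<forall>e. range e \<subseteq> univ M \<longrightarrow> sat M e \<phi>)"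

definition expansion ::
    "('f, 'r) lang \<Rightarrow> ('a, 'f, 'r) struct \<Rightarrow> ('f, 'r) lang \<Rightarrow> ('a, 'f, 'r) struct \<Rightarrow> bool" where
  "expansion L M L' M' \<longleftrightarrow>
     sublang L L' \<and> is_struct L M \<and> is_struct L' M' \<and> univ M' = univ M \<and>
     (\<forall>(f, n) \<in> funs L. \<forall>xs \<in> tuples (univ M) n. fn M' f xs = fn M f xs) \<and>
     (\<forall>(r, n) \<in> rels L. \<forall>xs \<in> tuples (univ M) n. rel M' r xs \<longleftrightarrow> rel M r xs)"

definition isomorphism ::
    "('f, 'r) lang \<Rightarrow> ('a, 'f, 'r) struct \<Rightarrow> ('b, 'f, 'r) struct \<Rightarrow> ('a \<Rightarrow> 'b) \<Rightarrow> bool" where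
  "isomorphism L M N h \<longleftrightarrow> bij_betw h (univ M) (univ N) \<and>
     (\<forall>(f, n) \<in> funs L. \<forall>xs \<in> tuples (univ M) n. h (fn M f xs) = fn N f (map h xs)) \<and>
     (\<forall>(r, n) \<in> rels L. \<forall>xs \<in> tuples (univ M) n. rel M r xs \<longleftrightarrow> rel N r (map h xs))"


section \<open>Peano arithmetic\<close>

text \<open>
  The symbols of \<open>L\<^sub>A\<close> together with a supply of further symbol names for
  the languages extending it.
\<close>

datatype 'f fsym = Zero | Succ | Plus | Times | XFun 'f

datatype 'r rsym = Less | XRel 'r

definition LA :: "('f fsym, 'r rsym) lang" where
  "LA = \<lparr>funs = {(Zero, 0), (Succ, 1), (Plus, 2), (Times, 2)}, rels = {(Less, 2)}\<rparr>"

abbreviation ZeroT :: "'f fsym tm" where "ZeroT \<equiv> Fn Zero []"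
abbreviation SuccT :: "'f fsym tm \<Rightarrow> 'f fsym tm" where "SuccT t \<equiv> Fn Succ [t]"
abbreviation Add :: "'f fsym tm \<Rightarrow> 'f fsym tm \<Rightarrow> 'f fsym tm" where "Add s t \<equiv> Fn Plus [s, t]"
abbreviation Mul :: "'f fsym tm \<Rightarrow> 'f fsym tm \<Rightarrow> 'f fsym tm" where "Mul s t \<equiv> Fn Times [s, t]"
abbreviation Lt :: "'f fsym tm \<Rightarrow> 'f fsym tm \<Rightarrow> ('f fsym, 'r rsym) fm" where "Lt s t \<equiv> Rl Less [s, t]"

definition PA_basic :: "('f fsym, 'r rsym) fm set" where
  "PA_basic = {
     Neg (Eq (SuccT (Var 0)) ZeroT),
     Imp (Eq (SuccT (Var 0)) (SuccT (Var 1))) (Eq (Var 0) (Var 1)),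
     Eq (Add (Var 0) ZeroT) (Var 0),
     Eq (Add (Var 0) (SuccT (Var 1))) (SuccT (Add (Var 0) (Var 1))),
     Eq (Mul (Var 0) ZeroT) ZeroT,
     Eq (Mul (Var 0) (SuccT (Var 1))) (Add (Mul (Var 0) (Var 1)) (Var 0)),
     Iff (Lt (Var 0) (Var 1)) (Exists (Eq (Add (Var 1) (SuccT (Var 0))) (Var 2)))}"

text \<open>Induction on the variable \<open>0\<close>; the other free variables of \<open>\<phi>\<close> are parameters.\<close>

definition induction_axiom :: "('f fsym, 'r rsym) fm \<Rightarrow> ('f fsym, 'r rsym) fm" where
  "induction_axiom \<phi> =
     Imp (Conj (subst_fm (case_nat ZeroT Var) \<phi>)
               (Forall (Imp \<phi> (subst_fm (case_nat (SuccT (Var 0)) (\<lambda>n. Var (Suc n))) \<phi>))))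
         (Forall \<phi>)"

definition PA :: "('f fsym, 'r rsym) lang \<Rightarrow> ('f fsym, 'r rsym) fm set" where
  "PA L = PA_basic \<union> induction_axiom ` {\<phi>. fm_in L \<phi>}"


section \<open>Definability and interpretations\<close>

text \<open>
  A definable set of \<open>n\<close>-tuples: the variables below \<open>n\<close> are the coordinates, the
  remaining ones are evaluated by the parameter assignment \<open>p\<close>, of which only finitely many
  values matter.
\<close>

definition definable :: "('f, 'r) lang \<Rightarrow> ('a, 'f, 'r) struct \<Rightarrow> 'a list set \<Rightarrow> bool" where
  "definable L M X \<longleftrightarrow> (\<exists>n \<phi> p. fm_in L \<phi> \<and> range p \<subseteq> univ M \<and>
     X = {xs \<in> tuples (univ M) n. sat M (\<lambda>i. if i < n then xs ! i else p (i - n)) \<phi>})"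

text \<open>
  An interpretation presents \<open>N\<close> inside \<open>M\<close> by an injective coordinate map \<open>c\<close> from the
  universe of \<open>N\<close> onto a definable set of tuples of some fixed length; tuples of elements of
  \<open>N\<close> are represented by concatenation. When the universe of \<open>N\<close> literally is a subset of
  that of \<open>M\<close>, the coordinate map is \<open>\<lambda>x. [x]\<close>, called \<open>self\<close> below. Equality of \<open>N\<close> is true equality, not
  a definable equivalence relation.
\<close>

definition interprets ::
    "('f, 'r) lang \<Rightarrow> ('a, 'f, 'r) struct \<Rightarrow> ('b \<Rightarrow> 'a list) \<Rightarrow>
     ('g, 's) lang \<Rightarrow> ('b, 'g, 's) struct \<Rightarrow> bool" where
  "interprets L M c K N \<longleftrightarrow>
     is_struct L M \<and> is_struct K N \<and> inj_on c (univ N) \<and> definable L M (c ` univ N) \<and>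
     (\<forall>(f, n) \<in> funs K.
        definable L M ((\<lambda>xs. concat (map c xs) @ c (fn N f xs)) ` tuples (univ N) n)) \<and>
     (\<forall>(r, n) \<in> rels K.
        definable L M ((\<lambda>xs. concat (map c xs)) ` {xs \<in> tuples (univ N) n. rel N r xs}))"

definition self :: "'a \<Rightarrow> 'a list" where
  "self x = [x]"

definition compose_coords :: "('b \<Rightarrow> 'a list) \<Rightarrow> ('c \<Rightarrow> 'b list) \<Rightarrow> 'c \<Rightarrow> 'a list" where
  "compose_coords c d x = concat (map c (d x))"

text \<open>Definability in \<open>M\<close> of \<open>h\<close>, with domain \<open>A\<close> presented by \<open>c\<close> and codomain by \<open>d\<close>.\<close>

definition definable_map ::
    "('f, 'r) lang \<Rightarrow> ('a, 'f, 'r) struct \<Rightarrow> ('b \<Rightarrow> 'a list) \<Rightarrow> 'b set \<Rightarrow>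
     ('c \<Rightarrow> 'a list) \<Rightarrow> ('b \<Rightarrow> 'c) \<Rightarrow> bool" where
  "definable_map L M c A d h \<longleftrightarrow> definable L M ((\<lambda>x. c x @ d (h x)) ` A)"

text \<open>
  Same universe and same arithmetic: \<open>N\<close> expands the reduct of \<open>M\<close> to \<open>L\<^sub>A\<close>, which is
  \<open>M\<close> itself read as a structure for \<^term>\<open>LA\<close>.
\<close>

definition omega_interpretable ::
    "('f fsym, 'r rsym) lang \<Rightarrow> ('a, 'f fsym, 'r rsym) struct \<Rightarrow>
     ('f fsym, 'r rsym) lang \<Rightarrow> ('a, 'f fsym, 'r rsym) struct \<Rightarrow> bool" where
  "omega_interpretable L M K N \<longleftrightarrow> interprets L M self K N \<and> expansion LA M K N"

end

theory Submission
  imports Defs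
begin

text \<open>
  In a model of \<open>PA(L)\<close>, coded bounded sets give definable primitive recursion, so there are an
  \<open>M\<^sub>1\<^sup>+\<close>-definable map \<open>h\<^sub>1: M\<^sub>1 \<rightarrow> M\<^sub>2\<close> and an
  \<open>M\<^sub>2\<^sup>+\<close>-definable map \<open>h\<^sub>2: M\<^sub>2 \<rightarrow> M\<^sub>3\<close> preserving zero and successor; by induction
  they are embeddings of \<open>L\<^sub>A\<close>-structures. Induction in \<open>M\<^sub>1\<^sup>+\<close>, applicable because
  both maps are \<open>M\<^sub>1\<^sup>+\<close>-definable, yields \<open>h\<^sub>2 \<circ> h\<^sub>1 = i\<^sub>0\<close>. As \<open>i\<^sub>0\<close> is
  onto and \<open>h\<^sub>2\<close> is injective, \<open>h\<^sub>1\<close> is onto.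
\<close>

section \<open>Definable predicates and functions of environments\<close>

text \<open>The obstacle is the bookkeeping of definability: every induction needs a formula, and
  formulas for coded computations and composed interpretations would be unmanageable if written out.
  Definability is therefore a property of HOL predicates and functions on environments, closed under
  connectives, quantifiers and substitution, with the parameters hidden in an existential; each
  induction then leaves a goal that closure rules settle. For the same reason tuples of coordinates
  are packed into single elements with a total decoding map, so that formulas over the interpreted
  structure translate with unrelativised quantifiers. Coded sets use Goedel's moduli, but membership
  is divisibility of one number by a modulus, so a product of moduli suffices and no remainders or
  Chinese remainder theorem are involved. Induction is needed for the expanded language because the
  induction formulas mention the symbols that occur in the interpretations and in the definition of
  \<open>i0\<close>.\<close>

lemma val_subst_tm: "val M e (subst_tm \<sigma> t) = val M (\<lambda>i. val M e (\<sigma> i)) t"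
  by (induction t) (auto cong: map_cong simp: comp_def)

lemma sat_subst_fm: "sat M e (subst_fm \<sigma> \<phi>) \<longleftrightarrow> sat M (\<lambda>i. val M e (\<sigma> i)) \<phi>"
proof (induction \<phi> arbitrary: e \<sigma>)
  case (Rl r ts)
  then show ?case by (simp add: val_subst_tm comp_def)
next
  case (Forall \<phi>)
  have "(\<lambda>i. val M (case_nat a e) (case_nat (Var 0) (\<lambda>n. subst_tm (\<lambda>m. Var (Suc m)) (\<sigma> n)) i))
      = case_nat a (\<lambda>i. val M e (\<sigma> i))" for a
    by (rule ext) (simp add: val_subst_tm split: nat.split)
  then show ?case by (simp add: Forall)
qed (simp_all add: val_subst_tm)

lemma tm_in_subst_tm: "tm_in L t \<Longrightarrow> (\<And>i. tm_in L (\<sigma> i)) \<Longrightarrow> tm_in L (subst_tm \<sigma> t)"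
  by (induction t) auto

lemma fm_in_subst_fm: "fm_in L \<phi> \<Longrightarrow> (\<And>i. tm_in L (\<sigma> i)) \<Longrightarrow> fm_in L (subst_fm \<sigma> \<phi>)"
proof (induction \<phi> arbitrary: \<sigma>)
  case (Forall \<phi>)
  then show ?case by (simp add: tm_in_subst_tm split: nat.split)
qed (auto intro: tm_in_subst_tm)

text \<open>A term is a finite object and inspects finitely many slots. The resulting bound later
  lets an infinite family of substitutions be cut down to a finite one.\<close>

lemma val_finite_support: "\<exists>n. \<forall>e e'. (\<forall>i<n. e i = e' i) \<longrightarrow> val M e t = val M e' t"
proof (induction t)
  case (Var i)
  show ?case by (rule exI[of _ "Suc i"]) simp
next
  case (Fn f ts)
  then obtain n where n: "\<And>t e e'. t \<in> set ts \<Longrightarrow> (\<forall>i<n t. e i = e' i) \<Longrightarrow> val M e t = val M e' t"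
    by metis
  show ?case
  proof (intro exI allI impI)
    fix e e' :: "nat \<Rightarrow> 'a"
    \<comment> \<open>Inserting 0 keeps \<open>Max\<close> meaningful when \<open>ts\<close> is
      empty.\<close>
    assume e: "\<forall>i < Max (insert 0 (n ` set ts)). e i = e' i"
    have "val M e t = val M e' t" if "t \<in> set ts" for t
      by (rule n[OF that]) (use e that in \<open>auto simp: Max_gr_iff\<close>)
    then show "val M e (Fn f ts) = val M e' (Fn f ts)"
      by (simp cong: map_cong)
  qed
qed

lemma sat_finite_support: "\<exists>n. \<forall>e e'. (\<forall>i<n. e i = e' i) \<longrightarrow> sat M e \<phi> = sat M e' \<phi>"
proof (induction \<phi>)
  case (Eq s t)
  obtain m n where mn: "\<And>e e'. (\<forall>i<m. e i = e' i) \<Longrightarrow> val M e s = val M e' s"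
    "\<And>e e'. (\<forall>i<n. e i = e' i) \<Longrightarrow> val M e t = val M e' t"
    using val_finite_support[of M s] val_finite_support[of M t] by blast
  show ?case
  proof (intro exI[of _ "max m n"] allI impI)
    fix e e' :: "nat \<Rightarrow> 'a"
    assume "\<forall>i<max m n. e i = e' i"
    then show "sat M e (Eq s t) = sat M e' (Eq s t)"
      using mn(1)[of e e'] mn(2)[of e e'] by simp
  qed
next
  case (Rl r ts)
  obtain n where n: "\<And>t e e'. (\<forall>i<n t. e i = e' i) \<Longrightarrow> val M e t = val M e' t"
    using val_finite_support by metis
  show ?case
  proof (intro exI allI impI)
    fix e e' :: "nat \<Rightarrow> 'a"
    assume e: "\<forall>i < Max (insert 0 (n ` set ts)). e i = e' i"
    have "val M e t = val M e' t" if "t \<in> set ts" for t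
      by (rule n) (use e that in \<open>auto simp: Max_gr_iff\<close>)
    then show "sat M e (Rl r ts) = sat M e' (Rl r ts)"
      by (simp cong: map_cong)
  qed
next
  case (Neg \<phi>)
  then show ?case by simp
next
  case (Conj \<phi> \<psi>)
  then obtain m n where mn: "\<And>e e'. (\<forall>i<m. e i = e' i) \<Longrightarrow> sat M e \<phi> = sat M e' \<phi>"
    "\<And>e e'. (\<forall>i<n. e i = e' i) \<Longrightarrow> sat M e \<psi> = sat M e' \<psi>"
    by blast
  show ?case
  proof (intro exI[of _ "max m n"] allI impI)
    fix e e' :: "nat \<Rightarrow> 'a"
    assume "\<forall>i<max m n. e i = e' i"
    then show "sat M e (Conj \<phi> \<psi>) = sat M e' (Conj \<phi> \<psi>)"
      using mn(1)[of e e'] mn(2)[of e e'] by simp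
  qed
next
  case (Forall \<phi>)
  then obtain n where n: "\<And>e e'. (\<forall>i<n. e i = e' i) \<Longrightarrow> sat M e \<phi> = sat M e' \<phi>"
    by blast
  show ?case
  proof (intro exI allI impI)
    fix e e' :: "nat \<Rightarrow> 'a"
    assume "\<forall>i<n. e i = e' i"
    \<comment> \<open>The bound \<open>n\<close> of the body serves unchanged: a positive slot
      \<open>i\<close> of \<open>case_nat a e\<close> is slot \<open>i - 1\<close> of
      \<open>e\<close>, so agreement below \<open>n\<close> is more than enough.\<close>
    then have "sat M (case_nat a e) \<phi> = sat M (case_nat a e') \<phi>" for a
      by (intro n) (simp split: nat.split)
    then show "sat M e (Forall \<phi>) = sat M e' (Forall \<phi>)" by simp
  qed
qed

text \<open>Variables sit at even positions and parameters at odd ones, so that both are unlimited.\<close>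

definition mix :: "(nat \<Rightarrow> 'a) \<Rightarrow> (nat \<Rightarrow> 'a) \<Rightarrow> nat \<Rightarrow> 'a" where
  "mix e p i = (if even i then e (i div 2) else p (i div 2))"

lemma mix_even [simp]: "mix e p (2 * i) = e i"
  and mix_odd [simp]: "mix e p (Suc (2 * i)) = p i"
  by (simp_all add: mix_def)

lemma range_mix: "range e \<subseteq> A \<Longrightarrow> range p \<subseteq> A \<Longrightarrow> range (mix e p) \<subseteq> A"
  by (auto simp: mix_def)

lemma range_case_nat: "a \<in> A \<Longrightarrow> range e \<subseteq> A \<Longrightarrow> range (case_nat a e) \<subseteq> A"
  by (auto simp: image_subset_iff split: nat.split)

section \<open>Closure properties of predicates and functions definable with parameters\<close>

locale fo_structure =
  fixes L :: "('f, 'r) lang" and M :: "('a, 'f, 'r) struct"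
  assumes is_struct: "is_struct L M"
begin

abbreviation U :: "'a set" where "U \<equiv> univ M"

text \<open>A semantic notion: the formula and its parameters are existentially quantified, and only
  environments with values in \<open>U\<close> count, so \<open>P\<close> may be any HOL expression
  with the right extension there.\<close>

definition dpred :: "((nat \<Rightarrow> 'a) \<Rightarrow> bool) \<Rightarrow> bool" where
  "dpred P \<longleftrightarrow> (\<exists>\<phi> p. fm_in L \<phi> \<and> range p \<subseteq> U \<and>
     (\<forall>e. range e \<subseteq> U \<longrightarrow> (P e \<longleftrightarrow> sat M (mix e p) \<phi>)))"

text \<open>Definability of the graph, with the value in slot 0 and the arguments shifted up by
  one.\<close>

definition dfun :: "((nat \<Rightarrow> 'a) \<Rightarrow> 'a) \<Rightarrow> bool" where
  "dfun t \<longleftrightarrow> (\<forall>e. range e \<subseteq> U \<longrightarrow> t e \<in> U) \<and> dpred (\<lambda>e. e 0 = t (\<lambda>i. e (Suc i)))"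

lemma dpred_cong:
  assumes "dpred P" and "\<And>e. range e \<subseteq> U \<Longrightarrow> P e \<longleftrightarrow> Q e"
  shows "dpred Q"
  using assms unfolding dpred_def by simp

lemma dfunD: "dfun t \<Longrightarrow> range e \<subseteq> U \<Longrightarrow> t e \<in> U"
  by (simp add: dfun_def)

lemma dfun_cong:
  assumes "dfun s" and "\<And>e. range e \<subseteq> U \<Longrightarrow> s e = t e"
  shows "dfun t"
proof -
  have "range (\<lambda>i. e (Suc i)) \<subseteq> U" if "range e \<subseteq> U" for e
    using that by auto
  then show ?thesis
    using assms unfolding dfun_def by (auto elim!: dpred_cong)
qed

lemma univ_nonempty: "U \<noteq> {}"
  using is_struct by (simp add: is_struct_def)

lemma fn_closed: "(f, length xs) \<in> funs L \<Longrightarrow> set xs \<subseteq> U \<Longrightarrow> fn M f xs \<in> U"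
  using is_struct by (force simp: is_struct_def tuples_def)

lemma dpred_rename:
  assumes "dpred P"
  shows "dpred (\<lambda>e. P (\<lambda>i. e (\<rho> i)))"
proof -
  from assms obtain \<phi> p where \<phi>: "fm_in L \<phi>" "range p \<subseteq> U"
    "\<And>e. range e \<subseteq> U \<Longrightarrow> P e \<longleftrightarrow> sat M (mix e p) \<phi>"
    unfolding dpred_def by blast
  define \<sigma> where "\<sigma> i = (if even i then 2 * \<rho> (i div 2) else i)" for i
  have mix: "mix (\<lambda>i. e (\<rho> i)) p = (\<lambda>i. mix e p (\<sigma> i))" for e
    by (auto simp: \<sigma>_def mix_def)
  show ?thesis
    unfolding dpred_def
  proof (intro exI conjI allI impI)
    show "fm_in L (subst_fm (\<lambda>i. Var (\<sigma> i)) \<phi>)"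
      using \<phi>(1) by (simp add: fm_in_subst_fm)
    fix e :: "nat \<Rightarrow> 'a" assume "range e \<subseteq> U"
    then have "range (\<lambda>i. e (\<rho> i)) \<subseteq> U" by auto
    then show "P (\<lambda>i. e (\<rho> i)) \<longleftrightarrow> sat M (mix e p) (subst_fm (\<lambda>i. Var (\<sigma> i)) \<phi>)"
      by (simp add: \<phi>(3) sat_subst_fm mix)
  qed (fact \<phi>(2))
qed

lemma dpred_not: "dpred P \<Longrightarrow> dpred (\<lambda>e. \<not> P e)"
  unfolding dpred_def by (metis fm_in.simps(3) sat.simps(3))

lemma dpred_conj:
  assumes "dpred P" "dpred Q"
  shows "dpred (\<lambda>e. P e \<and> Q e)"
proof -
  from assms obtain \<phi> p \<psi> q where \<phi>: "fm_in L \<phi>" "range p \<subseteq> U"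
    "\<And>e. range e \<subseteq> U \<Longrightarrow> P e \<longleftrightarrow> sat M (mix e p) \<phi>"
    and \<psi>: "fm_in L \<psi>" "range q \<subseteq> U"
    "\<And>e. range e \<subseteq> U \<Longrightarrow> Q e \<longleftrightarrow> sat M (mix e q) \<psi>"
    unfolding dpred_def by metis
  \<comment> \<open>Both parameter assignments are merged into \<open>mix p q\<close>:
    \<open>\<sigma>\<close> sends a parameter to the even places of the merged assignment,
    \<open>\<tau>\<close> to the odd ones, and both fix the variables.\<close>
  define \<sigma> \<tau> :: "nat \<Rightarrow> nat" where
    "\<sigma> i = (if even i then i else Suc (2 * (2 * (i div 2))))" and
    "\<tau> i = (if even i then i else Suc (2 * Suc (2 * (i div 2))))" for i
  have "mix e p = (\<lambda>i. mix e (mix p q) (\<sigma> i))" "mix e q = (\<lambda>i. mix e (mix p q) (\<tau> i))" for e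
    by (auto simp: \<sigma>_def \<tau>_def fun_eq_iff mix_def elim!: oddE)
  note mix = this
  show ?thesis
    unfolding dpred_def
  proof (intro exI conjI allI impI)
    show "fm_in L (Conj (subst_fm (\<lambda>i. Var (\<sigma> i)) \<phi>) (subst_fm (\<lambda>i. Var (\<tau> i)) \<psi>))"
      using \<phi>(1) \<psi>(1) by (simp add: fm_in_subst_fm)
    show "range (mix p q) \<subseteq> U"
      by (rule range_mix[OF \<phi>(2) \<psi>(2)])
    fix e :: "nat \<Rightarrow> 'a" assume "range e \<subseteq> U"
    then show "P e \<and> Q e \<longleftrightarrow> sat M (mix e (mix p q))
        (Conj (subst_fm (\<lambda>i. Var (\<sigma> i)) \<phi>) (subst_fm (\<lambda>i. Var (\<tau> i)) \<psi>))"
      using \<phi>(3)[of e] \<psi>(3)[of e] mix[of e] by (simp add: sat_subst_fm)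
  qed
qed

text \<open>Used backwards, the conclusion is a higher-order pattern that determines
  \<open>P\<close>; the premise then beta-reduces to the usual shift, with the bound variable in
  slot 0.\<close>

lemma dpred_all:
  assumes "dpred (\<lambda>e. P (e 0) (\<lambda>i. e (Suc i)))"
  shows "dpred (\<lambda>e. \<forall>a\<in>U. P a e)"
proof -
  from assms obtain \<phi> p where \<phi>: "fm_in L \<phi>" "range p \<subseteq> U"
    "\<And>e. range e \<subseteq> U \<Longrightarrow> P (e 0) (\<lambda>i. e (Suc i)) \<longleftrightarrow> sat M (mix e p) \<phi>"
    unfolding dpred_def by blast
  \<comment> \<open>Under the quantifier the environment is \<open>case_nat a (mix e p)\<close>.
    Variable \<open>j + 1\<close>, at place \<open>2j + 2\<close>, is found at place
    \<open>2j + 1\<close>; a parameter at an odd place moves up by one.\<close>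
  define \<sigma> where "\<sigma> i = (if i = 0 then 0 else if even i then i - 1 else Suc i)" for i :: nat
  have mix: "mix (case_nat a e) p = (\<lambda>i. case_nat a (mix e p) (\<sigma> i))" for a e
  proof
    fix i show "mix (case_nat a e) p i = case_nat a (mix e p) (\<sigma> i)"
    proof (cases "even i")
      case True
      then obtain j where "i = 2 * j" by blast
      then show ?thesis by (cases j) (auto simp: \<sigma>_def mix_def)
    qed (auto simp: \<sigma>_def mix_def)
  qed
  show ?thesis
    unfolding dpred_def
  proof (intro exI conjI allI impI)
    show "fm_in L (Forall (subst_fm (\<lambda>i. Var (\<sigma> i)) \<phi>))"
      using \<phi>(1) by (simp add: fm_in_subst_fm)
    fix e :: "nat \<Rightarrow> 'a" assume e: "range e \<subseteq> U"
    have "P a e \<longleftrightarrow> sat M (mix (case_nat a e) p) \<phi>" if "a \<in> U" for a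
      using \<phi>(3)[OF range_case_nat[OF that e]] by simp
    then show "(\<forall>a\<in>U. P a e) \<longleftrightarrow> sat M (mix e p) (Forall (subst_fm (\<lambda>i. Var (\<sigma> i)) \<phi>))"
      by (simp add: sat_subst_fm mix)
  qed (fact \<phi>(2))
qed

lemma dpred_ex:
  assumes "dpred (\<lambda>e. P (e 0) (\<lambda>i. e (Suc i)))"
  shows "dpred (\<lambda>e. \<exists>a\<in>U. P a e)"
proof -
  have "dpred (\<lambda>e. \<not> (\<forall>a\<in>U. \<not> P a e))"
    by (intro dpred_not dpred_all assms)
  then show ?thesis by simp
qed

lemma dpred_disj:
  assumes "dpred P" "dpred Q"
  shows "dpred (\<lambda>e. P e \<or> Q e)"
proof -
  have "dpred (\<lambda>e. \<not> (\<not> P e \<and> \<not> Q e))"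
    by (intro dpred_not dpred_conj assms)
  then show ?thesis by simp
qed

lemma dpred_imp:
  assumes "dpred P" "dpred Q"
  shows "dpred (\<lambda>e. P e \<longrightarrow> Q e)"
proof -
  have "dpred (\<lambda>e. \<not> P e \<or> Q e)"
    by (intro dpred_not dpred_disj assms)
  then show ?thesis by simp
qed

lemma dpred_iff:
  assumes "dpred P" "dpred Q"
  shows "dpred (\<lambda>e. P e \<longleftrightarrow> Q e)"
proof -
  have "dpred (\<lambda>e. (P e \<longrightarrow> Q e) \<and> (Q e \<longrightarrow> P e))"
    by (intro dpred_conj dpred_imp assms)
  then show ?thesis by (rule dpred_cong) blast
qed

lemma dpred_const: "dpred (\<lambda>e. b)"
proof -
  have "dpred (\<lambda>e. True)"
    unfolding dpred_def
    by (intro exI[of _ "Eq (Var 0) (Var 0)"]) (use univ_nonempty in auto)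
  from this dpred_not[OF this] show ?thesis
    by (cases b) simp_all
qed

lemma dfun_var: "dfun (\<lambda>e. e i)"
proof -
  have "dpred (\<lambda>e. e 0 = e (Suc i))"
    unfolding dpred_def
    by (intro exI[of _ "Eq (Var 0) (Var (2 * Suc i))"]) (use univ_nonempty in \<open>auto simp: mix_def\<close>)
  then show ?thesis
    by (auto simp: dfun_def)
qed

lemma dfun_const: "a \<in> U \<Longrightarrow> dfun (\<lambda>e. a)"
  unfolding dfun_def dpred_def
  by (intro conjI exI[of _ "Eq (Var 0) (Var 1)"] exI[of _ "\<lambda>_. a"]) (auto simp: mix_def)

lemma dpred_finite_support:
  assumes "dpred P"
  shows "\<exists>n. \<forall>e e'. range e \<subseteq> U \<longrightarrow> range e' \<subseteq> U \<longrightarrow> (\<forall>i<n. e i = e' i) \<longrightarrow> P e = P e'"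
proof -
  from assms obtain \<phi> p where \<phi>: "\<And>e. range e \<subseteq> U \<Longrightarrow> P e \<longleftrightarrow> sat M (mix e p) \<phi>"
    unfolding dpred_def by blast
  obtain n where n: "\<forall>e e'. (\<forall>i<n. e i = e' i) \<longrightarrow> sat M e \<phi> = sat M e' \<phi>"
    using sat_finite_support[of M \<phi>] ..
  have "sat M (mix e p) \<phi> = sat M (mix e' p) \<phi>" if "\<forall>i<n. e i = e' i" for e e'
    by (rule n[rule_format]) (use that in \<open>auto simp: mix_def\<close>)
  then show ?thesis
    by (intro exI[of _ n] allI impI) (simp add: \<phi>)
qed

text \<open>The value of \<open>t\<close> is named by an existential quantifier, since
  \<open>t\<close> need not be given by a term.\<close>

lemma dpred_subst_zero:
  assumes P: "dpred P" and t: "dfun t"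
  shows "dpred (\<lambda>e. P (case_nat (t e) e))"
proof -
  have eq: "dpred (\<lambda>e. e 0 = t (\<lambda>i. e (Suc i)))"
    using t by (simp add: dfun_def)
  have "(\<lambda>e. P (case_nat (e 0) (\<lambda>i. e (Suc i)))) = P"
    by (intro ext arg_cong[where f = P]) (simp split: nat.split)
  with P have "dpred (\<lambda>e. P (case_nat (e 0) (\<lambda>i. e (Suc i))))" by simp
  from dpred_ex[OF dpred_conj[OF eq this]] show ?thesis
    by (rule dpred_cong) (auto dest: dfunD[OF t])
qed

lemma dfun_rename:
  assumes "dfun t"
  shows "dfun (\<lambda>e. t (\<lambda>i. e (\<rho> i)))"
  unfolding dfun_def
proof (intro conjI allI impI)
  fix e :: "nat \<Rightarrow> 'a" assume "range e \<subseteq> U"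
  then have "range (\<lambda>i. e (\<rho> i)) \<subseteq> U" by auto
  with assms show "t (\<lambda>i. e (\<rho> i)) \<in> U" by (rule dfunD)
next
  have "dpred (\<lambda>e. e 0 = t (\<lambda>i. e (Suc i)))"
    using assms by (simp add: dfun_def)
  from dpred_rename[OF this, of "case_nat 0 (\<lambda>i. Suc (\<rho> i))"]
  show "dpred (\<lambda>e. e 0 = t (\<lambda>i. e (Suc (\<rho> i))))" by simp
qed

text \<open>Infinitely many slots are replaced at once. By finite support only the first
  \<open>n\<close> matter, and these are replaced one at a time; \<open>W n t e\<close> is the state
  in which \<open>e\<close> survives behind \<open>n\<close> substituted slots.\<close>

lemma dpred_subst:
  assumes "dpred P" and t: "\<And>i. dfun (t i)"
  shows "dpred (\<lambda>e. P (\<lambda>i. t i e))"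
proof -
  define W where "W n t e = (\<lambda>i. if i < n then t i e else e (i - n))"
    for n and t :: "nat \<Rightarrow> (nat \<Rightarrow> 'a) \<Rightarrow> 'a" and e
  have W_Suc: "W (Suc n) t e = case_nat (t 0 e) (W n (\<lambda>i. t (Suc i)) e)" for n t e
    by (auto simp: W_def split: nat.split)
  have W_shift: "(\<lambda>i. W n t e (i + n)) = e" for n t e
    by (simp add: W_def)
  have *: "dpred (\<lambda>e. P (W n t e))" if "dpred P" "\<And>i. dfun (t i)" for n P t
    using that
  proof (induction n arbitrary: P t)
    case 0
    then show ?case by (simp add: W_def)
  next
    case (Suc n)
    \<comment> \<open>The term \<open>t 0\<close> must see the original environment, which the
      \<open>n\<close> remaining substitutions will have pushed back by \<open>n\<close>
      places.\<close>
    have "dpred (\<lambda>e. P (case_nat (t 0 (\<lambda>i. e (i + n))) e))"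
      by (rule dpred_subst_zero[OF Suc.prems(1) dfun_rename[OF Suc.prems(2), where \<rho> = "\<lambda>i. i + n"]])
    from Suc.IH[OF this, of "\<lambda>i. t (Suc i)"] Suc.prems(2) show ?case
      by (simp add: W_Suc W_shift)
  qed
  obtain n where n: "\<And>e e'. range e \<subseteq> U \<Longrightarrow> range e' \<subseteq> U \<Longrightarrow> (\<forall>i<n. e i = e' i) \<Longrightarrow> P e = P e'"
    using dpred_finite_support[OF assms(1)] by metis
  show ?thesis
  proof (rule dpred_cong[OF *[OF assms, of n]])
    fix e :: "nat \<Rightarrow> 'a" assume "range e \<subseteq> U"
    then show "P (W n t e) \<longleftrightarrow> P (\<lambda>i. t i e)"
      by (intro n) (use dfunD[OF t] in \<open>auto simp: W_def\<close>)
  qed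
qed

lemma dfun_subst:
  assumes s: "dfun s" and t: "\<And>i. dfun (t i)"
  shows "dfun (\<lambda>e. s (\<lambda>i. t i e))"
proof -
  have eq: "dpred (\<lambda>e. e 0 = s (\<lambda>i. e (Suc i)))"
    using s by (simp add: dfun_def)
  have "dfun (case_nat (\<lambda>e. e 0) (\<lambda>i e. t i (\<lambda>j. e (Suc j))) k)" for k
    using dfun_var[of 0] dfun_rename[OF t, where \<rho> = Suc] by (simp split: nat.split)
  from dpred_subst[where t = "case_nat (\<lambda>e. e 0) (\<lambda>i e. t i (\<lambda>j. e (Suc j)))", OF eq this] have "dpred (\<lambda>e. e 0 = s (\<lambda>i. t i (\<lambda>j. e (Suc j))))"
    by simp
  moreover have "s (\<lambda>i. t i e) \<in> U" if "range e \<subseteq> U" for e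
    by (rule dfunD[OF s]) (use dfunD[OF t that] in auto)
  ultimately show ?thesis by (simp add: dfun_def)
qed

lemma dpred_subst1: "dpred (\<lambda>e. P (e 0)) \<Longrightarrow> dfun s \<Longrightarrow> dpred (\<lambda>e. P (s e))"
  using dpred_subst[of "\<lambda>e. P (e 0)" "\<lambda>_. s"] by simp

lemma dpred_subst2:
  "dpred (\<lambda>e. P (e 0) (e 1)) \<Longrightarrow> dfun s \<Longrightarrow> dfun t \<Longrightarrow> dpred (\<lambda>e. P (s e) (t e))"
  using dpred_subst[of "\<lambda>e. P (e 0) (e 1)" "case_nat s (\<lambda>_. t)"] by (simp split: nat.split)

lemma dfun_subst1: "dfun (\<lambda>e. f (e 0)) \<Longrightarrow> dfun s \<Longrightarrow> dfun (\<lambda>e. f (s e))"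
  using dfun_subst[of "\<lambda>e. f (e 0)" "\<lambda>_. s"] by simp

lemma dpred_eq: "dfun s \<Longrightarrow> dfun t \<Longrightarrow> dpred (\<lambda>e. s e = t e)"
  by (rule dpred_subst2[where P = "(=)"]) (use dfun_var[of 0] in \<open>simp_all add: dfun_def\<close>)

text \<open>A definable description \<open>Q\<close> that singles out the value of \<open>t\<close>
  among the elements of \<open>U\<close> suffices, which allows \<open>t\<close> itself to be
  defined by choice or by cases.\<close>

lemma dfunI:
  assumes "dpred (\<lambda>e. Q (e 0) (\<lambda>i. e (Suc i)))"
    and "\<And>e. range e \<subseteq> U \<Longrightarrow> t e \<in> U"
    and "\<And>a e. a \<in> U \<Longrightarrow> range e \<subseteq> U \<Longrightarrow> Q a e \<longleftrightarrow> a = t e"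
  shows "dfun t"
proof -
  have "dpred (\<lambda>e. e 0 = t (\<lambda>i. e (Suc i)))"
  proof (rule dpred_cong[OF assms(1)])
    fix e :: "nat \<Rightarrow> 'a" assume "range e \<subseteq> U"
    then show "Q (e 0) (\<lambda>i. e (Suc i)) \<longleftrightarrow> e 0 = t (\<lambda>i. e (Suc i))"
      by (intro assms(3)) auto
  qed
  with assms(2) show ?thesis by (simp add: dfun_def)
qed

lemma dfun_fn:
  assumes "(f, length ts) \<in> funs L" and "\<And>t. t \<in> set ts \<Longrightarrow> dfun t"
  shows "dfun (\<lambda>e. fn M f (map (\<lambda>t. t e) ts))"
proof -
  define n where "n = length ts"
  \<comment> \<open>Substitution expects a function for every slot, so the finite list
    \<open>ts\<close> is padded with a projection that is never read.\<close>
  have map_ts: "map (\<lambda>i. (if i < n then ts ! i else (\<lambda>e. e 0)) e) [0..<n] = map (\<lambda>t. t e) ts" for e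
    by (rule nth_equalityI) (simp_all add: n_def)
  have "fn M f (map e [0..<n]) \<in> U" if "range e \<subseteq> U" for e
    using fn_closed[of f "map e [0..<n]"] assms(1) that by (auto simp: n_def)
  moreover have "dpred (\<lambda>e. e 0 = fn M f (map (\<lambda>i. e (Suc i)) [0..<n]))"
    unfolding dpred_def
  proof (intro exI conjI)
    show "fm_in L (Eq (Var 0) (Fn f (map (\<lambda>i. Var (2 * Suc i)) [0..<n])))"
      using assms(1) by (simp add: n_def)
    show "range (\<lambda>_. SOME a. a \<in> U) \<subseteq> U"
      using univ_nonempty by (simp add: image_subset_iff some_in_eq)
  qed (simp add: comp_def mix_def)
  ultimately have "dfun (\<lambda>e. fn M f (map e [0..<n]))"
    by (simp add: dfun_def)
  from dfun_subst[OF this, of "\<lambda>i. if i < n then ts ! i else (\<lambda>e. e 0)"] show ?thesis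
    unfolding map_ts using assms(2) dfun_var[of 0] by (simp add: n_def)
qed

lemmas dpred_intros = dpred_not dpred_conj dpred_disj dpred_imp dpred_iff dpred_all dpred_ex dpred_eq

end

section \<open>Arithmetic in a model of \<open>PA(L)\<close>\<close>

locale pa_structure = fo_structure L M
  for L :: "('f fsym, 'r rsym) lang" and M :: "('a, 'f fsym, 'r rsym) struct" +
  assumes LA_sublang: "sublang LA L" and models_PA: "models L M (PA L)"
begin

abbreviation zero :: 'a ("\<zero>") where "\<zero> \<equiv> fn M Zero []"
abbreviation succ :: "'a \<Rightarrow> 'a" where "succ x \<equiv> fn M Succ [x]"
abbreviation add :: "'a \<Rightarrow> 'a \<Rightarrow> 'a" (infixl "\<oplus>" 65) where "x \<oplus> y \<equiv> fn M Plus [x, y]"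
abbreviation mult :: "'a \<Rightarrow> 'a \<Rightarrow> 'a" (infixl "\<otimes>" 70) where "x \<otimes> y \<equiv> fn M Times [x, y]"

lemma arith_symbols:
  "(Zero, 0) \<in> funs L" "(Succ, Suc 0) \<in> funs L" "(Plus, Suc (Suc 0)) \<in> funs L" "(Times, Suc (Suc 0)) \<in> funs L"
  using LA_sublang by (auto simp: sublang_def LA_def numeral_2_eq_2)

lemma arith_closed [simp]:
  "\<zero> \<in> U" "x \<in> U \<Longrightarrow> succ x \<in> U"
  "x \<in> U \<Longrightarrow> y \<in> U \<Longrightarrow> x \<oplus> y \<in> U" "x \<in> U \<Longrightarrow> y \<in> U \<Longrightarrow> x \<otimes> y \<in> U"
  by (simp_all add: fn_closed arith_symbols)

lemma dfun_arith:
  "dfun (\<lambda>e. \<zero>)" "dfun s \<Longrightarrow> dfun (\<lambda>e. succ (s e))"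
  "dfun s \<Longrightarrow> dfun t \<Longrightarrow> dfun (\<lambda>e. s e \<oplus> t e)" "dfun s \<Longrightarrow> dfun t \<Longrightarrow> dfun (\<lambda>e. s e \<otimes> t e)"
  using dfun_fn[of Zero "[]"] dfun_fn[of Succ "[s]"] dfun_fn[of Plus "[s, t]"] dfun_fn[of Times "[s, t]"]
  by (auto simp: arith_symbols)

lemmas definable_intros = dpred_intros dfun_arith dfun_var

lemma sat_PA: "\<phi> \<in> PA L \<Longrightarrow> range e \<subseteq> U \<Longrightarrow> sat M e \<phi>"
  using models_PA by (simp add: models_def)

text \<open>Two values are enough because the basic axioms have no free variables beyond
  \<open>Var 0\<close> and \<open>Var 1\<close>.\<close>

lemma sat_PA_basic:
  assumes "\<phi> \<in> PA_basic" "x \<in> U" "y \<in> U"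
  shows "sat M (case_nat x (\<lambda>_. y)) \<phi>"
  using assms by (intro sat_PA) (auto simp: PA_def split: nat.split)

lemma succ_nonzero [simp]: "x \<in> U \<Longrightarrow> succ x \<noteq> \<zero>" "x \<in> U \<Longrightarrow> \<zero> \<noteq> succ x"
  using sat_PA_basic[of "Neg (Eq (SuccT (Var 0)) ZeroT)" x x]
  by (auto simp: PA_basic_def dest: sym)

lemma succ_inject [simp]: "x \<in> U \<Longrightarrow> y \<in> U \<Longrightarrow> succ x = succ y \<longleftrightarrow> x = y"
  using sat_PA_basic[of "Imp (Eq (SuccT (Var 0)) (SuccT (Var 1))) (Eq (Var 0) (Var 1))" x y]
  by (auto simp: PA_basic_def)

lemma add_zero [simp]: "x \<in> U \<Longrightarrow> x \<oplus> \<zero> = x"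
  using sat_PA_basic[of "Eq (Add (Var 0) ZeroT) (Var 0)" x x] by (simp add: PA_basic_def)

lemma add_succ [simp]: "x \<in> U \<Longrightarrow> y \<in> U \<Longrightarrow> x \<oplus> succ y = succ (x \<oplus> y)"
  using sat_PA_basic[of "Eq (Add (Var 0) (SuccT (Var 1))) (SuccT (Add (Var 0) (Var 1)))" x y]
  by (simp add: PA_basic_def)

lemma mult_zero [simp]: "x \<in> U \<Longrightarrow> x \<otimes> \<zero> = \<zero>"
  using sat_PA_basic[of "Eq (Mul (Var 0) ZeroT) ZeroT" x x] by (simp add: PA_basic_def)

lemma mult_succ [simp]: "x \<in> U \<Longrightarrow> y \<in> U \<Longrightarrow> x \<otimes> succ y = x \<otimes> y \<oplus> x"
  using sat_PA_basic[of "Eq (Mul (Var 0) (SuccT (Var 1))) (Add (Mul (Var 0) (Var 1)) (Var 0))" x y]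
  by (simp add: PA_basic_def)

lemma Less_iff:
  assumes "x \<in> U" "y \<in> U"
  shows "rel M Less [x, y] \<longleftrightarrow> (\<exists>z\<in>U. x \<oplus> succ z = y)"
  using sat_PA_basic[of "Iff (Lt (Var 0) (Var 1)) (Exists (Eq (Add (Var 1) (SuccT (Var 0))) (Var 2)))" x y] assms
  by (auto simp: PA_basic_def numeral_2_eq_2 split del: if_split)

text \<open>The induction axiom turned into a rule for HOL predicates; the price is the case
  \<open>definable\<close>, which the closure rules discharge.\<close>

lemma PA_induct [consumes 1, case_names definable zero succ]:
  assumes x: "x \<in> U" and D: "dpred (\<lambda>e. P (e 0))"
    and zero: "P \<zero>" and succ: "\<And>x. x \<in> U \<Longrightarrow> P x \<Longrightarrow> P (succ x)"
  shows "P x"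
proof -
  from D obtain \<phi> p where \<phi>: "fm_in L \<phi>" "range p \<subseteq> U"
    "\<And>e. range e \<subseteq> U \<Longrightarrow> P (e 0) \<longleftrightarrow> sat M (mix e p) \<phi>"
    unfolding dpred_def by blast
  \<comment> \<open>\<open>P\<close> reads slot 0 only, so the other variables are fixed at zero and
    absorbed, together with \<open>p\<close>, into the parameters of the induction axiom.\<close>
  define r where "r i = mix (\<lambda>_. \<zero>) p (Suc i)" for i
  have r: "range r \<subseteq> U"
    using \<phi>(2) by (auto simp: r_def mix_def)
  have mix_r: "mix (case_nat a (\<lambda>_. \<zero>)) p = case_nat a r" for a
  proof
    fix i show "mix (case_nat a (\<lambda>_. \<zero>)) p i = case_nat a r i"
      by (cases i) (auto simp: r_def mix_def elim!: oddE)
  qed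
  have P: "P a \<longleftrightarrow> sat M (case_nat a r) \<phi>" if "a \<in> U" for a
    using \<phi>(3)[of "case_nat a (\<lambda>_. \<zero>)"] that by (simp add: range_case_nat mix_r)
  have "(\<lambda>i. val M r (case_nat ZeroT Var i)) = case_nat \<zero> r"
    "(\<lambda>i. val M (case_nat a r) (case_nat (SuccT (Var 0)) (\<lambda>n. Var (Suc n)) i)) = case_nat (succ a) r" for a
    by (auto split: nat.split)
  moreover have "sat M r (induction_axiom \<phi>)"
    using \<phi>(1) r by (intro sat_PA) (auto simp: PA_def)
  ultimately have "P \<zero> \<Longrightarrow> (\<forall>a\<in>U. P a \<longrightarrow> P (succ a)) \<Longrightarrow> \<forall>a\<in>U. P a"
    by (simp add: induction_axiom_def sat_subst_fm P)
  with zero succ x show ?thesis by blast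
qed

section \<open>Semiring laws, order and pairing\<close>

lemma zero_add [simp]: "x \<in> U \<Longrightarrow> \<zero> \<oplus> x = x"
proof (induction rule: PA_induct)
  case definable
  show ?case by (intro definable_intros)
qed simp_all

lemma succ_add [simp]:
  assumes x: "x \<in> U" and "y \<in> U"
  shows "succ x \<oplus> y = succ (x \<oplus> y)"
  using assms(2)
proof (induction rule: PA_induct)
  case definable
  show ?case by (intro definable_intros dfun_const x)
qed (simp_all add: x)

lemma add_commute:
  assumes x: "x \<in> U" and "y \<in> U"
  shows "x \<oplus> y = y \<oplus> x"
  using assms(2)
proof (induction rule: PA_induct)
  case definable
  show ?case by (intro definable_intros dfun_const x)
qed (simp_all add: x)

lemma add_assoc:
  assumes x: "x \<in> U" and y: "y \<in> U" and "z \<in> U"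
  shows "x \<oplus> y \<oplus> z = x \<oplus> (y \<oplus> z)"
  using assms(3)
proof (induction rule: PA_induct)
  case definable
  show ?case by (intro definable_intros dfun_const x y)
qed (simp_all add: x y)

lemma add_left_commute:
  assumes "x \<in> U" "y \<in> U" "z \<in> U"
  shows "x \<oplus> (y \<oplus> z) = y \<oplus> (x \<oplus> z)"
  using assms by (metis add_assoc add_commute)

lemma add_left_cancel [simp]:
  assumes "x \<in> U" and y: "y \<in> U" and z: "z \<in> U"
  shows "x \<oplus> y = x \<oplus> z \<longleftrightarrow> y = z"
  using assms(1)
proof (induction rule: PA_induct)
  case definable
  show ?case by (intro definable_intros dfun_const dpred_const y z)
qed (simp_all add: y z)

lemma zero_or_succ:
  assumes "x \<in> U"
  shows "x = \<zero> \<or> (\<exists>y\<in>U. x = succ y)"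
  using assms
proof (induction rule: PA_induct)
  case definable
  show ?case by (intro definable_intros)
qed auto

lemma add_eq_zero:
  assumes "x \<in> U" "y \<in> U"
  shows "x \<oplus> y = \<zero> \<longleftrightarrow> x = \<zero> \<and> y = \<zero>"
  using zero_or_succ[OF assms(2)] assms(1) by auto

lemma zero_mult [simp]: "x \<in> U \<Longrightarrow> \<zero> \<otimes> x = \<zero>"
proof (induction rule: PA_induct)
  case definable
  show ?case by (intro definable_intros)
qed simp_all

lemma succ_mult [simp]:
  assumes x: "x \<in> U" and "y \<in> U"
  shows "succ x \<otimes> y = x \<otimes> y \<oplus> y"
  using assms(2)
proof (induction rule: PA_induct)
  case definable
  show ?case by (intro definable_intros dfun_const x)
next
  case (succ y)
  then show ?case by (simp add: x add_assoc add_commute add_left_commute)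
qed (simp_all add: x)

lemma mult_commute:
  assumes x: "x \<in> U" and "y \<in> U"
  shows "x \<otimes> y = y \<otimes> x"
  using assms(2)
proof (induction rule: PA_induct)
  case definable
  show ?case by (intro definable_intros dfun_const x)
qed (simp_all add: x)

lemma mult_add_distrib:
  assumes x: "x \<in> U" and y: "y \<in> U" and "z \<in> U"
  shows "x \<otimes> (y \<oplus> z) = x \<otimes> y \<oplus> x \<otimes> z"
  using assms(3)
proof (induction rule: PA_induct)
  case definable
  show ?case by (intro definable_intros dfun_const x y)
qed (simp_all add: x y add_assoc)

lemma add_mult_distrib:
  assumes "x \<in> U" "y \<in> U" "z \<in> U"
  shows "(x \<oplus> y) \<otimes> z = x \<otimes> z \<oplus> y \<otimes> z"
  using assms by (simp add: mult_commute[of _ z] mult_add_distrib)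

lemma mult_assoc:
  assumes x: "x \<in> U" and y: "y \<in> U" and "z \<in> U"
  shows "x \<otimes> y \<otimes> z = x \<otimes> (y \<otimes> z)"
  using assms(3)
proof (induction rule: PA_induct)
  case definable
  show ?case by (intro definable_intros dfun_const x y)
qed (simp_all add: x y mult_add_distrib)

lemma mult_left_commute:
  assumes "x \<in> U" "y \<in> U" "z \<in> U"
  shows "x \<otimes> (y \<otimes> z) = y \<otimes> (x \<otimes> z)"
  using assms by (metis mult_assoc mult_commute)

lemmas arith_simps = add_assoc add_commute add_left_commute
  mult_assoc mult_commute mult_left_commute mult_add_distrib add_mult_distrib

text \<open>Order expressed through addition, so that only the additive laws are used below; the
  symbol \<open>Less\<close> re-enters through \<open>Less_iff\<close> when isomorphisms are
  built.\<close>

definition lt :: "'a \<Rightarrow> 'a \<Rightarrow> bool" where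
  "lt x y \<longleftrightarrow> (\<exists>w\<in>U. x \<oplus> succ w = y)"

lemma dpred_lt: "dfun s \<Longrightarrow> dfun t \<Longrightarrow> dpred (\<lambda>e. lt (s e) (t e))"
  unfolding lt_def by (intro definable_intros dfun_rename[where \<rho> = Suc])

lemma not_lt_zero: "x \<in> U \<Longrightarrow> \<not> lt x \<zero>"
  by (simp add: lt_def)

lemma lt_succ:
  assumes "x \<in> U" "y \<in> U"
  shows "lt x (succ y) \<longleftrightarrow> lt x y \<or> x = y"
proof
  assume "lt x (succ y)"
  then obtain w where "w \<in> U" "x \<oplus> w = y"
    using assms by (auto simp: lt_def)
  then show "lt x y \<or> x = y"
    using zero_or_succ[of w] assms by (auto simp: lt_def)
next
  assume "lt x y \<or> x = y"
  then obtain w where "w \<in> U" "x \<oplus> w = y"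
    using assms unfolding lt_def by (metis add_zero arith_closed(1,2))
  then show "lt x (succ y)"
    using assms by (auto simp: lt_def)
qed

lemma lt_trichotomy:
  assumes x: "x \<in> U" and "y \<in> U"
  shows "lt x y \<or> x = y \<or> lt y x"
  using assms(2)
proof (induction rule: PA_induct)
  case definable
  show ?case by (intro definable_intros dpred_lt dfun_const x)
next
  case zero
  show ?case using zero_or_succ[OF x] by (auto simp: lt_def)
next
  case (succ y)
  have "lt (succ y) x \<or> succ y = x" if "lt y x"
  proof -
    from that obtain w where "w \<in> U" "y \<oplus> succ w = x" by (auto simp: lt_def)
    then show ?thesis using zero_or_succ[of w] succ(1) by (auto simp: lt_def)
  qed
  then show ?case
    using succ x by (auto simp: lt_succ)
qed

text \<open>A quadratic pairing that avoids the halving in Cantor's function. It is injective but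
  not surjective, so projections need a default value.\<close>

definition pair :: "'a \<Rightarrow> 'a \<Rightarrow> 'a" where
  "pair x y = (x \<oplus> y) \<otimes> (x \<oplus> y) \<oplus> x"

lemma pair_closed [simp]: "x \<in> U \<Longrightarrow> y \<in> U \<Longrightarrow> pair x y \<in> U"
  by (simp add: pair_def)

lemma dfun_pair: "dfun s \<Longrightarrow> dfun t \<Longrightarrow> dfun (\<lambda>e. pair (s e) (t e))"
  unfolding pair_def by (intro dfun_arith)

text \<open>Squares increase by more than \<open>x\<close> between \<open>x + y\<close> and its successor.\<close>

lemma pair_neq:
  assumes xy: "x \<in> U" "y \<in> U" "x' \<in> U" "y' \<in> U" and lt: "lt (x \<oplus> y) (x' \<oplus> y')"
  shows "pair x y \<noteq> pair x' y'"
proof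
  assume eq: "pair x y = pair x' y'"
  obtain w where w: "w \<in> U" "x \<oplus> y \<oplus> succ w = x' \<oplus> y'"
    using lt by (auto simp: lt_def)
  define s v where "s = x \<oplus> y" and "v = succ w"
  have U: "s \<in> U" "v \<in> U" using xy w by (auto simp: s_def v_def)
  have "(s \<oplus> v) \<otimes> (s \<oplus> v) = s \<otimes> s \<oplus> (s \<otimes> v \<oplus> v \<otimes> (s \<oplus> v))"
    using U by (simp add: arith_simps)
  moreover have "s \<otimes> s \<oplus> x = (s \<oplus> v) \<otimes> (s \<oplus> v) \<oplus> x'"
    using eq w by (simp add: pair_def s_def v_def del: add_succ)
  ultimately have "x = s \<otimes> v \<oplus> v \<otimes> (s \<oplus> v) \<oplus> x'"
    using U xy by (simp add: add_assoc)
  also have "s \<otimes> v = x \<oplus> (y \<oplus> s \<otimes> w)"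
    using w xy by (simp add: v_def s_def arith_simps)
  also have "v \<otimes> (s \<oplus> v) = succ (v \<otimes> (s \<oplus> w) \<oplus> w)"
    using w U by (simp add: v_def)
  \<comment> \<open>The product \<open>s \<otimes> v\<close> already contains \<open>x\<close>, and
    \<open>v\<close> is a successor, so cancelling \<open>x\<close> leaves zero equal to a sum with
    a successor summand.\<close>
  finally have "x \<oplus> \<zero> = x \<oplus> (y \<oplus> s \<otimes> w \<oplus> succ (v \<otimes> (s \<oplus> w) \<oplus> w) \<oplus> x')"
    using w U xy by (simp add: add_assoc)
  then show False
    using w U xy by (subst (asm) add_left_cancel) simp_all
qed

text \<open>By trichotomy and \<open>pair_neq\<close>, equal codes have equal sums; the common
  square then cancels.\<close>

lemma pair_inject [simp]:
  assumes xy: "x \<in> U" "y \<in> U" "x' \<in> U" "y' \<in> U"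
  shows "pair x y = pair x' y' \<longleftrightarrow> x = x' \<and> y = y'"
proof
  assume eq: "pair x y = pair x' y'"
  have s: "x \<oplus> y = x' \<oplus> y'"
    using lt_trichotomy[of "x \<oplus> y" "x' \<oplus> y'"] pair_neq[of x y x' y'] pair_neq[of x' y' x y] eq xy
    by auto
  then have "x = x'"
    using eq xy by (simp add: pair_def)
  with s show "x = x' \<and> y = y'"
    using xy by simp
qed simp

section \<open>Divisibility and coding of bounded definable sets\<close>

definition divides :: "'a \<Rightarrow> 'a \<Rightarrow> bool" where
  "divides u x \<longleftrightarrow> (\<exists>z\<in>U. u \<otimes> z = x)"

lemma dpred_divides: "dfun s \<Longrightarrow> dfun t \<Longrightarrow> dpred (\<lambda>e. divides (s e) (t e))"
  unfolding divides_def by (intro definable_intros dfun_rename[where \<rho> = Suc])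

lemma divides_mult:
  assumes "u \<in> U" "x \<in> U" "z \<in> U" "divides u x"
  shows "divides u (z \<otimes> x)"
proof -
  obtain p where "p \<in> U" "u \<otimes> p = x" using assms(4) by (auto simp: divides_def)
  then show ?thesis
    unfolding divides_def using assms by (intro bexI[of _ "z \<otimes> p"]) (auto simp: mult_left_commute)
qed

text \<open>There is no subtraction in \<open>U\<close>, so the two quotients are compared: their
  difference is the quotient of \<open>y\<close> if it is positive, and in the other two cases
  \<open>y\<close> is forced to be zero.\<close>

lemma divides_diff:
  assumes U: "u \<in> U" "x \<in> U" "y \<in> U" and x: "divides u x" and xy: "divides u (x \<oplus> y)"
  shows "divides u y"
proof -
  obtain p q where p: "p \<in> U" "x = u \<otimes> p" and q: "q \<in> U" "u \<otimes> p \<oplus> y = u \<otimes> q"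
    using x xy by (auto simp: divides_def)
  consider "lt p q" | "p = q" | "lt q p"
    using lt_trichotomy p q by blast
  then show ?thesis
  proof cases
    case 1
    then obtain w where w: "w \<in> U" "q = p \<oplus> succ w" by (auto simp: lt_def)
    have "u \<otimes> q = u \<otimes> p \<oplus> u \<otimes> succ w"
      unfolding w(2) using U p w by (intro mult_add_distrib) auto
    then have "y = u \<otimes> succ w"
      using q U p w by (simp del: mult_succ)
    then show ?thesis
      using w by (auto simp: divides_def simp del: mult_succ intro!: bexI[of _ "succ w"])
  next
    case 2
    then have "u \<otimes> p \<oplus> y = u \<otimes> p \<oplus> \<zero>" using q U p by simp
    then have "y = \<zero>" using U p by (subst (asm) add_left_cancel) auto
    then show ?thesis using U by (auto simp: divides_def intro!: bexI[of _ \<zero>])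
  next
    case 3
    then obtain w where w: "w \<in> U" "p = q \<oplus> succ w" by (auto simp: lt_def)
    have "u \<otimes> p = u \<otimes> q \<oplus> u \<otimes> succ w"
      unfolding w(2) using U q w by (intro mult_add_distrib) auto
    then have "u \<otimes> q \<oplus> (u \<otimes> succ w \<oplus> y) = u \<otimes> q \<oplus> \<zero>"
      using q U p w by (simp add: add_assoc del: mult_succ)
    then have "u \<otimes> succ w \<oplus> y = \<zero>"
      using U q w by (subst (asm) add_left_cancel) auto
    then have "y = \<zero>"
      using U w by (simp add: add_eq_zero del: mult_succ)
    then show ?thesis using U by (auto simp: divides_def intro!: bexI[of _ \<zero>])
  qed
qed

text \<open>Coprimality in the form of Euclid's lemma, which makes it trivially multiplicative.\<close>

definition coprime_to :: "'a \<Rightarrow> 'a \<Rightarrow> bool" where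
  "coprime_to u v \<longleftrightarrow> (\<forall>z\<in>U. divides u (v \<otimes> z) \<longrightarrow> divides u z)"

lemma coprime_toD: "coprime_to u v \<Longrightarrow> divides u (v \<otimes> z) \<Longrightarrow> z \<in> U \<Longrightarrow> divides u z"
  by (simp add: coprime_to_def)

lemma dpred_coprime_to: "dfun s \<Longrightarrow> dfun t \<Longrightarrow> dpred (\<lambda>e. coprime_to (s e) (t e))"
  unfolding coprime_to_def by (intro definable_intros dpred_divides dfun_rename[where \<rho> = Suc])

text \<open>Goedel's moduli \<open>1 + (y + 1) b\<close> from the beta function.\<close>

definition modulus :: "'a \<Rightarrow> 'a \<Rightarrow> 'a" where
  "modulus b y = succ (succ y \<otimes> b)"

lemma modulus_closed [simp]: "b \<in> U \<Longrightarrow> y \<in> U \<Longrightarrow> modulus b y \<in> U"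
  by (simp add: modulus_def)

lemma dfun_modulus: "dfun s \<Longrightarrow> dfun t \<Longrightarrow> dfun (\<lambda>e. modulus (s e) (t e))"
  unfolding modulus_def by (intro dfun_arith)

text \<open>With \<open>u = (y + 1) b + 1\<close>, the number \<open>u z\<close> is
  \<open>(y + 1) b z + z\<close>; if \<open>u\<close> divides \<open>b z\<close>, it therefore
  divides \<open>z\<close>.\<close>

lemma coprime_to_modulus_base:
  assumes U: "b \<in> U" "y \<in> U"
  shows "coprime_to (modulus b y) b"
  unfolding coprime_to_def
proof (intro ballI impI)
  fix z assume z: "z \<in> U" and "divides (modulus b y) (b \<otimes> z)"
  then have "divides (modulus b y) (succ y \<otimes> (b \<otimes> z))"
    using U by (simp add: divides_mult del: succ_mult)
  moreover have "divides (modulus b y) (succ y \<otimes> (b \<otimes> z) \<oplus> z)"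
    using U z by (auto simp: divides_def modulus_def mult_assoc add_mult_distrib simp del: mult_succ intro!: bexI[of _ z])
  ultimately show "divides (modulus b y) z"
    by (rule divides_diff[rotated 3]) (use U z in auto)
qed

text \<open>First \<open>b\<close> is dropped from \<open>(t + 1) b z\<close>. Multiplying the
  remaining \<open>(t + 1) z\<close> by the cofactor \<open>r = b / (t + 1)\<close> produces
  \<open>b z\<close>, from which \<open>b\<close> is dropped again.\<close>

lemma coprime_to_modulus_diff:
  assumes U: "b \<in> U" "y \<in> U" "t \<in> U" and t: "divides (succ t) b"
  shows "coprime_to (modulus b y) (succ t \<otimes> b)"
  unfolding coprime_to_def
proof (intro ballI impI)
  let ?u = "modulus b y"
  obtain r where r: "r \<in> U" "b = succ t \<otimes> r" using t by (auto simp: divides_def)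
  fix z assume z: "z \<in> U" and "divides ?u (succ t \<otimes> b \<otimes> z)"
  moreover have "succ t \<otimes> b \<otimes> z = b \<otimes> (succ t \<otimes> z)"
    using U z mult_assoc[of "succ t" b z] mult_left_commute[of "succ t" b z] by (simp del: succ_mult)
  ultimately have "divides ?u (b \<otimes> (succ t \<otimes> z))"
    by (simp only:)
  then have "divides ?u (succ t \<otimes> z)"
    by (rule coprime_toD[OF coprime_to_modulus_base[OF U(1,2)]]) (use U z in auto)
  then have "divides ?u (r \<otimes> (succ t \<otimes> z))"
    by (rule divides_mult[rotated 3]) (use U z r(1) in auto)
  moreover have "r \<otimes> (succ t \<otimes> z) = b \<otimes> z"
    unfolding r(2) using U z r(1) mult_left_commute[of r "succ t" z] mult_assoc[of "succ t" r z]
    by (simp del: succ_mult)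
  ultimately have "divides ?u (b \<otimes> z)"
    by (simp only:)
  then show "divides ?u z"
    by (rule coprime_toD[OF coprime_to_modulus_base[OF U(1,2)]]) (use U z in auto)
qed

text \<open>Two moduli differ by \<open>(t + 1) b\<close> with \<open>t < n\<close>, where
  \<open>t + 1\<close> divides \<open>b\<close>. The Euclidean form of coprimality is not visibly
  symmetric, so both directions are proved for \<open>y < y'\<close>.\<close>

lemma coprime_to_modulus:
  assumes U: "b \<in> U" "y \<in> U" "y' \<in> U" "n \<in> U"
    and b: "\<And>i. i \<in> U \<Longrightarrow> lt i n \<Longrightarrow> divides (succ i) b"
    and y: "lt y n" "lt y' n" "y \<noteq> y'"
  shows "coprime_to (modulus b y) (modulus b y')"
proof -
  have *: "coprime_to (modulus b y) (modulus b y')" "coprime_to (modulus b y') (modulus b y)"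
    if U: "y \<in> U" "y' \<in> U" and y: "lt y y'" "lt y' n" for y y'
  proof -
    obtain t where t: "t \<in> U" "y' = y \<oplus> succ t" using y(1) by (auto simp: lt_def)
    obtain w where w: "w \<in> U" "n = y' \<oplus> succ w" using y(2) by (auto simp: lt_def)
    \<comment> \<open>This exhibits \<open>t < n\<close>, the bound under which
      \<open>succ t\<close> divides \<open>b\<close>.\<close>
    have "n = t \<oplus> succ (y \<oplus> succ w)"
      using t w U by (simp add: add_commute add_left_commute add_assoc)
    then have "divides (succ t) b"
      using t w U by (intro b) (auto simp: lt_def intro!: bexI[of _ "y \<oplus> succ w"] simp del: add_succ)
    then have cop: "coprime_to (modulus b v) (succ t \<otimes> b)" if "v \<in> U" for v
      using coprime_to_modulus_diff t \<open>b \<in> U\<close> that by blast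
    have "modulus b y' = modulus b y \<oplus> succ t \<otimes> b"
      using t U \<open>b \<in> U\<close> by (simp add: modulus_def arith_simps)
    then have eq: "modulus b y' \<otimes> z = modulus b y \<otimes> z \<oplus> succ t \<otimes> b \<otimes> z" if "z \<in> U" for z
      using that t U \<open>b \<in> U\<close> by (simp add: add_mult_distrib del: succ_mult)
    have self: "divides v (v \<otimes> z)" if "z \<in> U" for v z
      using that by (auto simp: divides_def)
    show "coprime_to (modulus b y) (modulus b y')"
      unfolding coprime_to_def
    proof (intro ballI impI)
      fix z assume z: "z \<in> U" "divides (modulus b y) (modulus b y' \<otimes> z)"
      then have "divides (modulus b y) (modulus b y \<otimes> z \<oplus> succ t \<otimes> b \<otimes> z)"
        by (simp only: eq)
      then have "divides (modulus b y) (succ t \<otimes> b \<otimes> z)"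
        by (rule divides_diff[rotated 4]) (use U t \<open>b \<in> U\<close> z(1) self in \<open>simp_all del: succ_mult\<close>)
      then show "divides (modulus b y) z"
        using coprime_toD[OF cop[of y]] U z by blast
    qed
    show "coprime_to (modulus b y') (modulus b y)"
      unfolding coprime_to_def
    proof (intro ballI impI)
      fix z assume z: "z \<in> U" "divides (modulus b y') (modulus b y \<otimes> z)"
      have "divides (modulus b y') (modulus b y \<otimes> z \<oplus> succ t \<otimes> b \<otimes> z)"
        using eq[OF z(1)] self[of z "modulus b y'"] z(1) by simp
      then have "divides (modulus b y') (succ t \<otimes> b \<otimes> z)"
        by (rule divides_diff[rotated 4]) (use U t \<open>b \<in> U\<close> z in \<open>auto simp del: succ_mult\<close>)
      then show "divides (modulus b y') z"
        using coprime_toD[OF cop[of y']] U z by blast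
    qed
  qed
  show ?thesis
    using lt_trichotomy[of y y'] U y * by blast
qed

text \<open>A substitute for the factorial, which is not yet available as a definable function.
  Writing it as a successor records that it is nonzero.\<close>

lemma exists_common_multiple:
  assumes "n \<in> U"
  shows "\<exists>c\<in>U. \<forall>i\<in>U. lt i n \<longrightarrow> divides (succ i) (succ c)"
  using assms
proof (induction rule: PA_induct)
  case definable
  show ?case by (intro definable_intros dpred_lt dpred_divides)
next
  case zero
  show ?case by (auto simp: not_lt_zero intro: arith_closed(1))
next
  case (succ n)
  then obtain c where c: "c \<in> U" "\<And>i. i \<in> U \<Longrightarrow> lt i n \<Longrightarrow> divides (succ i) (succ c)"
    by blast
  \<comment> \<open>The next multiple is \<open>(n + 1)(c + 1)\<close>, rewritten to display its
    predecessor.\<close>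
  have eq: "succ (succ c \<otimes> n \<oplus> c) = succ n \<otimes> succ c"
    using succ(1) c(1) by (simp add: arith_simps)
  have "divides (succ i) (succ n \<otimes> succ c)" if "i \<in> U" "lt i (succ n)" for i
  proof (cases "i = n")
    case True
    then show ?thesis using c(1) by (auto simp: divides_def simp del: mult_succ succ_mult)
  next
    case False
    then show ?thesis using that c succ(1) by (intro divides_mult) (auto simp: lt_succ)
  qed
  then show ?case
    using succ(1) c(1) by (intro bexI[of _ "succ c \<otimes> n \<oplus> c"]) (auto simp: eq simp del: mult_succ succ_mult)
qed

text \<open>The base is a successor, so the modulus is at least two; base zero would give modulus
  one.\<close>

lemma not_divides_one:
  assumes U: "b \<in> U" "y \<in> U"
  shows "\<not> divides (modulus (succ b) y) (succ \<zero>)"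
proof
  assume "divides (modulus (succ b) y) (succ \<zero>)"
  then obtain z where z: "z \<in> U" "modulus (succ b) y \<otimes> z = succ \<zero>"
    by (auto simp: divides_def)
  then show False
    using zero_or_succ[of z] U by (auto simp: modulus_def)
qed

text \<open>The code \<open>a\<close> is the product of the moduli of the elements of the set, built
  up in stages \<open>m\<close> while \<open>n\<close>, and hence \<open>b\<close>, stays
  fixed.\<close>

lemma bounded_comprehension:
  assumes P: "dpred (\<lambda>e. P (e 0))" and n: "n \<in> U"
  shows "\<exists>a\<in>U. \<exists>b\<in>U. \<forall>y\<in>U. lt y n \<longrightarrow> (divides (modulus b y) a \<longleftrightarrow> P y)"
proof -
  obtain c where c: "c \<in> U" "\<And>i. i \<in> U \<Longrightarrow> lt i n \<Longrightarrow> divides (succ i) (succ c)"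
    using exists_common_multiple[OF n] by blast
  define b where "b = succ c"
  have b: "b \<in> U" using c by (simp add: b_def)
  \<comment> \<open>Non-members carry coprimality rather than mere non-divisibility, because
    coprimality is what survives multiplication by further moduli.\<close>
  have "\<exists>a\<in>U. \<forall>y\<in>U. lt y n \<longrightarrow>
    (lt y m \<and> P y \<longrightarrow> divides (modulus b y) a) \<and> (\<not> (lt y m \<and> P y) \<longrightarrow> coprime_to (modulus b y) a)"
    if "m \<in> U" for m
    using that
  proof (induction rule: PA_induct)
    case definable
    show ?case
      by (intro definable_intros dpred_lt dpred_divides dpred_coprime_to dfun_modulus dfun_const b n
          dpred_subst1[OF P])
  next
    case zero
    show ?case
      \<comment> \<open>The empty product is one.\<close>
      by (intro bexI[of _ "succ \<zero>"]) (auto simp: not_lt_zero coprime_to_def)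
  next
    case (succ m)
    then obtain a where a: "a \<in> U"
      "\<And>y. y \<in> U \<Longrightarrow> lt y n \<Longrightarrow> lt y m \<Longrightarrow> P y \<Longrightarrow> divides (modulus b y) a"
      "\<And>y. y \<in> U \<Longrightarrow> lt y n \<Longrightarrow> \<not> (lt y m \<and> P y) \<Longrightarrow> coprime_to (modulus b y) a"
      by blast
    show ?case
    proof (cases "P m \<and> lt m n")
      case True
      have "divides (modulus b y) (modulus b m \<otimes> a)"
        if y: "y \<in> U" "lt y n" "lt y (succ m)" "P y" for y
      proof (cases "y = m")
        case True
        then show ?thesis using a(1) by (auto simp: divides_def)
      next
        case False
        then show ?thesis
          using y a b succ(1) by (intro divides_mult) (auto simp: lt_succ)
      qed
      moreover have "coprime_to (modulus b y) (modulus b m \<otimes> a)"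
        if y: "y \<in> U" "lt y n" "\<not> (lt y (succ m) \<and> P y)" for y
      proof -
        have "y \<noteq> m" "\<not> (lt y m \<and> P y)" using y True succ(1) by (auto simp: lt_succ)
        with y True have cop: "coprime_to (modulus b y) (modulus b m)" "coprime_to (modulus b y) a"
          using coprime_to_modulus[OF b y(1) succ(1) n c(2)[folded b_def]] a(3)[of y] by auto
        show ?thesis
          unfolding coprime_to_def
        proof (intro ballI impI)
          fix z assume z: "z \<in> U" "divides (modulus b y) (modulus b m \<otimes> a \<otimes> z)"
          then have "divides (modulus b y) (modulus b m \<otimes> (a \<otimes> z))"
            using a(1) b succ(1) by (simp add: mult_assoc)
          with cop z(1) a(1) show "divides (modulus b y) z"
            by (blast intro: coprime_toD arith_closed)
        qed
      qed
      ultimately show ?thesis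
        using a(1) b succ(1) by (intro bexI[of _ "modulus b m \<otimes> a"]) auto
    next
      case False
      \<comment> \<open>Stage \<open>m\<close> adds nothing below \<open>n\<close>, so the old code
        is kept; this also covers stages beyond \<open>n\<close>.\<close>
      then have "lt y (succ m) \<and> P y \<longleftrightarrow> lt y m \<and> P y" if "y \<in> U" "lt y n" for y
        using that succ(1) by (auto simp: lt_succ)
      then show ?thesis
        using a by (intro bexI[of _ a]) auto
    qed
  qed
  from this[OF n] obtain a where a: "a \<in> U"
    "\<And>y. y \<in> U \<Longrightarrow> lt y n \<Longrightarrow> P y \<Longrightarrow> divides (modulus b y) a"
    "\<And>y. y \<in> U \<Longrightarrow> lt y n \<Longrightarrow> \<not> P y \<Longrightarrow> coprime_to (modulus b y) a"
    by blast
  have "\<not> divides (modulus b y) a" if "y \<in> U" "lt y n" "\<not> P y" for y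
  proof
    assume "divides (modulus b y) a"
    \<comment> \<open>Writing \<open>a\<close> as \<open>a\<close> times one lets coprimality cancel
      \<open>a\<close>, leaving a modulus that divides one.\<close>
    then have "divides (modulus b y) (a \<otimes> succ \<zero>)" using a(1) by simp
    then have "divides (modulus b y) (succ \<zero>)"
      by (rule coprime_toD[OF a(3)[OF that]]) simp
    then show False
      using not_divides_one that c(1) by (simp add: b_def)
  qed
  with a b show ?thesis by blast
qed

text \<open>The triple \<open>(a, b, n)\<close> codes a bounded set.\<close>

definition mem :: "'a \<Rightarrow> 'a \<Rightarrow> 'a \<Rightarrow> 'a \<Rightarrow> bool" where
  "mem y a b n \<longleftrightarrow> lt y n \<and> divides (modulus b y) a"

lemma dpred_mem:
  "dfun r \<Longrightarrow> dfun s \<Longrightarrow> dfun t \<Longrightarrow> dfun u \<Longrightarrow> dpred (\<lambda>e. mem (r e) (s e) (t e) (u e))"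
  unfolding mem_def by (intro definable_intros dpred_lt dpred_divides dfun_modulus)

text \<open>The enlarged set is definable and bounded, so it is coded afresh by comprehension
  instead of modifying the old code.\<close>

lemma adjunction:
  assumes "a \<in> U" "b \<in> U" "n \<in> U" "y \<in> U"
  shows "\<exists>a'\<in>U. \<exists>b'\<in>U. \<exists>n'\<in>U. \<forall>z\<in>U. mem z a' b' n' \<longleftrightarrow> z = y \<or> mem z a b n"
proof -
  \<comment> \<open>This bound exceeds \<open>y\<close> and is above the old bound
    \<open>n\<close>.\<close>
  define n' where "n' = n \<oplus> succ y"
  have n': "n' \<in> U" using assms by (simp add: n'_def)
  have "dpred (\<lambda>e. e 0 = y \<or> mem (e 0) a b n)"
    by (intro definable_intros dpred_mem dfun_const assms)
  from bounded_comprehension[OF this n'] obtain a' b' where ab: "a' \<in> U" "b' \<in> U"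
    "\<And>z. z \<in> U \<Longrightarrow> lt z n' \<Longrightarrow> divides (modulus b' z) a' \<longleftrightarrow> z = y \<or> mem z a b n"
    by blast
  have "lt z n'" if "z \<in> U" "lt z n" for z
  proof -
    from that obtain w where w: "w \<in> U" "n = z \<oplus> succ w" by (auto simp: lt_def)
    then show ?thesis
      unfolding lt_def n'_def using that assms by (intro bexI[of _ "w \<oplus> succ y"]) (simp_all add: add_assoc)
  qed
  moreover have "lt y n'"
    unfolding lt_def n'_def using assms by (intro bexI[of _ n]) (simp_all add: add_commute)
  ultimately have "mem z a' b' n' \<longleftrightarrow> z = y \<or> mem z a b n" if "z \<in> U" for z
    using ab(3)[OF that] that unfolding mem_def[of z a' b' n'] by (auto simp: mem_def)
  with ab n' show ?thesis by blast
qed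

end

section \<open>Primitive recursion through coded computations\<close>

context pa_structure
begin

text \<open>
  \<open>H x u\<close> says that the pair of \<open>x\<close> and \<open>u\<close> lies in a coded set all of whose elements are
  justified by the recursion equations.
\<close>

lemma primitive_recursion:
  assumes u0: "u0 \<in> U" and g: "dfun (\<lambda>e. g (e 0))"
  shows "\<exists>h. dfun (\<lambda>e. h (e 0)) \<and> h \<zero> = u0 \<and> (\<forall>x\<in>U. h (succ x) = g (h x))"
proof -
  \<comment> \<open>A coded computation is only required to justify each of its pairs by a
    predecessor. It need not be single-valued; uniqueness is obtained afterwards by induction on
    \<open>x\<close>.\<close>
  define A where "A a b n \<longleftrightarrow> (\<forall>x\<in>U. \<forall>u\<in>U. mem (pair x u) a b n \<longrightarrow> x = \<zero> \<and> u = u0 \<or>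
    (\<exists>x'\<in>U. \<exists>u'\<in>U. x = succ x' \<and> u = g u' \<and> mem (pair x' u') a b n))" for a b n
  define H where "H x u \<longleftrightarrow> (\<exists>a\<in>U. \<exists>b\<in>U. \<exists>n\<in>U. A a b n \<and> mem (pair x u) a b n)" for x u
  have g_U: "g u \<in> U" if "u \<in> U" for u
    using dfunD[OF g, of "\<lambda>_. u"] that by auto
  have H_zero_or_succ: "x = \<zero> \<and> u = u0 \<or> (\<exists>x'\<in>U. \<exists>u'\<in>U. x = succ x' \<and> u = g u' \<and> H x' u')"
    if "H x u" "x \<in> U" "u \<in> U" for x u
  proof -
    from that(1) obtain a b n where abn: "a \<in> U" "b \<in> U" "n \<in> U" "A a b n" "mem (pair x u) a b n"
      unfolding H_def by blast
    have "x = \<zero> \<and> u = u0 \<or>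
      (\<exists>x'\<in>U. \<exists>u'\<in>U. x = succ x' \<and> u = g u' \<and> mem (pair x' u') a b n)"
      using abn(4)[unfolded A_def] abn(5) that(2,3) by blast
    with abn show ?thesis unfolding H_def by blast
  qed
  have H_zero: "H \<zero> u0"
  proof -
    \<comment> \<open>The triple of zeros codes the empty set because its bound is zero.\<close>
    obtain a b n where abn: "a \<in> U" "b \<in> U" "n \<in> U"
      and mem: "\<And>z. z \<in> U \<Longrightarrow> mem z a b n \<longleftrightarrow> z = pair \<zero> u0 \<or> mem z \<zero> \<zero> \<zero>"
      using adjunction[of \<zero> \<zero> \<zero> "pair \<zero> u0"] u0 by auto
    have mem': "mem z a b n \<longleftrightarrow> z = pair \<zero> u0" if "z \<in> U" for z
      using mem[OF that] not_lt_zero[OF that] by (simp add: mem_def[of z \<zero>])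
    have "A a b n"
      unfolding A_def using u0 by (simp add: mem')
    moreover have "mem (pair \<zero> u0) a b n"
      using u0 by (simp add: mem')
    ultimately show ?thesis unfolding H_def using abn by blast
  qed
  have H_succ: "H (succ x) (g u)" if H: "H x u" and xu: "x \<in> U" "u \<in> U" for x u
  proof -
    from H obtain a b n where abn: "a \<in> U" "b \<in> U" "n \<in> U" "A a b n" "mem (pair x u) a b n"
      unfolding H_def by blast
    obtain a' b' n' where abn': "a' \<in> U" "b' \<in> U" "n' \<in> U"
      and mem: "\<And>z. z \<in> U \<Longrightarrow> mem z a' b' n' \<longleftrightarrow> z = pair (succ x) (g u) \<or> mem z a b n"
      using adjunction[OF abn(1-3), of "pair (succ x) (g u)"] xu g_U by auto
    have "A a' b' n'"
      unfolding A_def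
    proof (intro ballI impI)
      fix y v assume yv: "y \<in> U" "v \<in> U" "mem (pair y v) a' b' n'"
      consider "y = succ x" "v = g u" | "mem (pair y v) a b n"
        using mem[of "pair y v"] yv xu g_U by auto
      then show "y = \<zero> \<and> v = u0 \<or>
          (\<exists>x'\<in>U. \<exists>u'\<in>U. y = succ x' \<and> v = g u' \<and> mem (pair x' u') a' b' n')"
      proof cases
        case 1
        then show ?thesis using xu abn(5) mem[of "pair x u"] by auto
      next
        case 2
        then have "y = \<zero> \<and> v = u0 \<or>
          (\<exists>x'\<in>U. \<exists>u'\<in>U. y = succ x' \<and> v = g u' \<and> mem (pair x' u') a b n)"
          using abn(4)[unfolded A_def] yv(1,2) by blast
        then show ?thesis using mem by (metis pair_closed)
      qed
    qed
    moreover have "mem (pair (succ x) (g u)) a' b' n'"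
      using mem[of "pair (succ x) (g u)"] xu g_U by simp
    ultimately show ?thesis unfolding H_def using abn' by blast
  qed
  have dpred_H: "dpred (\<lambda>e. H (e i) (e j))" for i j
    unfolding H_def A_def
    by (intro definable_intros dpred_mem dfun_pair dfun_const[OF u0] dfun_subst1[OF g])
  \<comment> \<open>Existence and uniqueness go together: any justification at \<open>succ x\<close>
    leads back to a value at \<open>x\<close>, which the hypothesis makes unique.\<close>
  have ex1: "\<exists>u\<in>U. H x u \<and> (\<forall>v\<in>U. H x v \<longrightarrow> v = u)" if "x \<in> U" for x
    using that
  proof (induction rule: PA_induct)
    case definable
    show ?case by (intro definable_intros dpred_H)
  next
    case zero
    have "v = u0" if "H \<zero> v" "v \<in> U" for v
      using H_zero_or_succ[OF that(1) _ that(2)] by auto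
    then show ?case using H_zero u0 by blast
  next
    case (succ x)
    then obtain u where u: "u \<in> U" "H x u" "\<And>v. v \<in> U \<Longrightarrow> H x v \<Longrightarrow> v = u" by blast
    have "v = g u" if "H (succ x) v" "v \<in> U" for v
      using H_zero_or_succ[OF that(1) _ that(2)] succ(1) u(3) by auto
    then show ?case using H_succ[OF u(2) succ(1) u(1)] g_U[OF u(1)] by blast
  qed
  define h where "h x = (SOME u. u \<in> U \<and> H x u)" for x
  have h: "h x \<in> U \<and> H x (h x)" if "x \<in> U" for x
    unfolding h_def by (rule someI_ex) (use ex1[OF that] in blast)
  have h_eq: "h x = u \<longleftrightarrow> H x u" if "x \<in> U" "u \<in> U" for x u
    using ex1[OF that(1)] h[OF that(1)] that(2) by blast
  have "dfun (\<lambda>e. h (e 0))"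
  proof (rule dfunI[where Q = "\<lambda>a e. H (e 0) a"])
    fix e :: "nat \<Rightarrow> 'a" and a
    assume e: "range e \<subseteq> U"
    then show "h (e 0) \<in> U" using h by auto
    assume "a \<in> U" with e h_eq[of "e 0" a] show "H (e 0) a \<longleftrightarrow> a = h (e 0)" by auto
  qed (rule dpred_H)
  moreover have "h \<zero> = u0" using h_eq H_zero u0 by simp
  moreover have "h (succ x) = g (h x)" if "x \<in> U" for x
    using h_eq[of "succ x" "g (h x)"] H_succ[of x "h x"] h[OF that] g_U that by simp
  ultimately show ?thesis by blast
qed

end

section \<open>Definable sets of tuples\<close>

context fo_structure
begin

text \<open>The length is the same for all environments, as needed to test membership in a set of
  tuples of fixed length.\<close>

definition dlist :: "((nat \<Rightarrow> 'a) \<Rightarrow> 'a list) \<Rightarrow> bool" where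
  "dlist F \<longleftrightarrow> (\<exists>ts. (\<forall>t\<in>set ts. dfun t) \<and> (\<forall>e. range e \<subseteq> U \<longrightarrow> F e = map (\<lambda>t. t e) ts))"

lemma dlist_map: "(\<And>i. i \<in> set is \<Longrightarrow> dfun (f i)) \<Longrightarrow> dlist (\<lambda>e. map (\<lambda>i. f i e) is)"
  unfolding dlist_def by (intro exI[of _ "map f is"]) (auto simp: comp_def)

lemma dlist_singleton: "dfun t \<Longrightarrow> dlist (\<lambda>e. [t e])"
  using dlist_map[of "[0 :: nat]" "\<lambda>_. t"] by simp

lemma dlist_append:
  assumes "dlist F" "dlist G"
  shows "dlist (\<lambda>e. F e @ G e)"
proof -
  from assms obtain ss ts where "\<forall>t\<in>set ss. dfun t" "\<forall>t\<in>set ts. dfun t"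
    and F: "\<And>e. range e \<subseteq> U \<Longrightarrow> F e = map (\<lambda>t. t e) ss"
    and G: "\<And>e. range e \<subseteq> U \<Longrightarrow> G e = map (\<lambda>t. t e) ts"
    unfolding dlist_def by blast
  then show ?thesis
    unfolding dlist_def by (intro exI[of _ "ss @ ts"]) auto
qed

lemma dlist_concat: "(\<And>i. i \<in> set is \<Longrightarrow> dlist (F i)) \<Longrightarrow> dlist (\<lambda>e. concat (map (\<lambda>i. F i e) is))"
proof (induction "is")
  case Nil
  show ?case unfolding dlist_def by (intro exI[of _ "[]"]) simp
next
  case (Cons i "is")
  then have "dlist (\<lambda>e. F i e @ concat (map (\<lambda>i. F i e) is))"
    by (intro dlist_append) simp_all
  then show ?case by simp
qed

lemma dlist_cong:
  assumes "dlist F" and "\<And>e. range e \<subseteq> U \<Longrightarrow> F e = G e"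
  shows "dlist G"
  using assms unfolding dlist_def by simp

text \<open>Carries the coordinate-based notion \<open>definable\<close> over to predicates on
  environments; \<open>definableI\<close> goes back.\<close>

lemma dpred_mem_definable:
  assumes X: "definable L M X" and F: "dlist F"
  shows "dpred (\<lambda>e. F e \<in> X)"
proof -
  from X obtain n \<phi> p where \<phi>: "fm_in L \<phi>" and p: "range p \<subseteq> U"
    and X_eq: "X = {xs \<in> tuples U n. sat M (\<lambda>i. if i < n then xs ! i else p (i - n)) \<phi>}"
    unfolding definable_def by blast
  from F obtain ts where ts: "\<forall>t\<in>set ts. dfun t"
    and F_eq: "\<And>e. range e \<subseteq> U \<Longrightarrow> F e = map (\<lambda>t. t e) ts"
    unfolding dlist_def by blast
  have in_tuples: "F e \<in> tuples U n \<longleftrightarrow> length ts = n" if "range e \<subseteq> U" for e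
    using ts that by (auto simp: F_eq tuples_def dfunD)
  show ?thesis
  proof (cases "length ts = n")
    case False
    then show ?thesis
      by (intro dpred_cong[OF dpred_const[of False]]) (simp add: X_eq in_tuples)
  next
    case True
    have "dpred (\<lambda>e. sat M e \<phi>)"
      unfolding dpred_def
    proof (intro exI conjI)
      show "fm_in L (subst_fm (\<lambda>i. Var (2 * i)) \<phi>)" using \<phi> by (simp add: fm_in_subst_fm)
      show "range p \<subseteq> U" by (fact p)
    qed (simp add: sat_subst_fm)
    moreover have "dfun (if i < n then ts ! i else (\<lambda>e. p (i - n)))" for i
      using ts p True dfun_const[of "p (i - n)"] by auto
    ultimately have "dpred (\<lambda>e. sat M (\<lambda>i. (if i < n then ts ! i else (\<lambda>e. p (i - n))) e) \<phi>)"
      by (rule dpred_subst)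
    then show ?thesis
    proof (rule dpred_cong)
      fix e :: "nat \<Rightarrow> 'a" assume e: "range e \<subseteq> U"
      have "(\<lambda>i. (if i < n then ts ! i else (\<lambda>e. p (i - n))) e) =
          (\<lambda>i. if i < n then F e ! i else p (i - n))"
        using True by (auto simp: F_eq[OF e])
      then show "sat M (\<lambda>i. (if i < n then ts ! i else (\<lambda>e. p (i - n))) e) \<phi> \<longleftrightarrow> F e \<in> X"
        using True in_tuples[OF e] by (simp add: X_eq)
    qed
  qed
qed

lemma definableI:
  assumes X: "X \<subseteq> tuples U n" and D: "dpred (\<lambda>e. map e [0..<n] \<in> X)"
  shows "definable L M X"
proof -
  from D obtain \<phi> p where \<phi>: "fm_in L \<phi>" and p: "range p \<subseteq> U"
    and X_iff: "\<And>e. range e \<subseteq> U \<Longrightarrow> map e [0..<n] \<in> X \<longleftrightarrow> sat M (mix e p) \<phi>"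
    unfolding dpred_def by blast
  define a where "a = p 0"
  \<comment> \<open>Coordinates from \<open>n\<close> on are irrelevant and all point to slot
    \<open>n\<close>, which holds the default \<open>a\<close>; the parameters begin one slot
    later.\<close>
  define \<sigma> where "\<sigma> i = (if even i then min (i div 2) n else n + Suc (i div 2))" for i
  show ?thesis
    unfolding definable_def
  proof (intro exI conjI)
    show "fm_in L (subst_fm (\<lambda>i. Var (\<sigma> i)) \<phi>)" using \<phi> by (simp add: fm_in_subst_fm)
    show "range (case_nat a p) \<subseteq> U" using p by (intro range_case_nat) (auto simp: a_def)
    show "X = {xs \<in> tuples U n.
        sat M (\<lambda>i. if i < n then xs ! i else case_nat a p (i - n)) (subst_fm (\<lambda>i. Var (\<sigma> i)) \<phi>)}"
    proof -
      have "xs \<in> X \<longleftrightarrow>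
          sat M (\<lambda>i. if i < n then xs ! i else case_nat a p (i - n)) (subst_fm (\<lambda>i. Var (\<sigma> i)) \<phi>)"
        if xs: "xs \<in> tuples U n" for xs
      proof -
        define e where "e i = (if i < n then xs ! i else a)" for i
        have e: "range e \<subseteq> U"
          using xs p by (auto simp: e_def a_def tuples_def)
        have "map e [0..<n] = xs"
          using xs by (intro nth_equalityI) (auto simp: e_def tuples_def)
        moreover have "(\<lambda>i. if \<sigma> i < n then xs ! \<sigma> i else case_nat a p (\<sigma> i - n)) = mix e p"
          by (auto simp: fun_eq_iff \<sigma>_def mix_def e_def min_def)
        ultimately show ?thesis
          using X_iff[OF e] by (simp add: sat_subst_fm)
      qed
      then show ?thesis using X by blast
    qed
  qed
qed

end

section \<open>Coding tuples by single elements\<close>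

context pa_structure
begin

text \<open>The explicit default keeps the projection in \<open>U\<close> and definable off the
  range of \<open>pair\<close>, where bare choice would be uncontrolled.\<close>

definition unpair1 :: "'a \<Rightarrow> 'a" where
  "unpair1 u = (if \<exists>x\<in>U. \<exists>y\<in>U. u = pair x y then SOME x. x \<in> U \<and> (\<exists>y\<in>U. u = pair x y) else \<zero>)"

definition unpair2 :: "'a \<Rightarrow> 'a" where
  "unpair2 u = (if \<exists>y\<in>U. \<exists>x\<in>U. u = pair x y then SOME y. y \<in> U \<and> (\<exists>x\<in>U. u = pair x y) else \<zero>)"

lemma unpair_pair [simp]:
  assumes "x \<in> U" "y \<in> U"
  shows "unpair1 (pair x y) = x" "unpair2 (pair x y) = y"
proof -
  have "(SOME x'. x' \<in> U \<and> (\<exists>y'\<in>U. pair x y = pair x' y')) = x"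
    by (rule some_equality) (use assms in auto)
  then show "unpair1 (pair x y) = x" using assms by (auto simp: unpair1_def)
  have "(SOME y'. y' \<in> U \<and> (\<exists>x'\<in>U. pair x y = pair x' y')) = y"
    by (rule some_equality) (use assms in auto)
  then show "unpair2 (pair x y) = y" using assms by (auto simp: unpair2_def)
qed

lemma dfun_unpair1: "dfun (\<lambda>e. unpair1 (e 0))"
proof (rule dfunI[where Q = "\<lambda>a e. (\<exists>y\<in>U. e 0 = pair a y) \<or>
    a = \<zero> \<and> \<not> (\<exists>x\<in>U. \<exists>y\<in>U. e 0 = pair x y)"])
  show "dpred (\<lambda>e. (\<exists>y\<in>U. e (Suc 0) = pair (e 0) y) \<or>
      e 0 = \<zero> \<and> \<not> (\<exists>x\<in>U. \<exists>y\<in>U. e (Suc 0) = pair x y))"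
    by (intro definable_intros dfun_pair)
next
  fix e :: "nat \<Rightarrow> 'a" assume "range e \<subseteq> U"
  have "unpair1 u \<in> U" for u
  proof (cases "\<exists>x\<in>U. \<exists>y\<in>U. u = pair x y")
    case False
    then show ?thesis unfolding unpair1_def by (subst if_not_P) simp_all
  qed auto
  then show "unpair1 (e 0) \<in> U" .
next
  fix a and e :: "nat \<Rightarrow> 'a" assume a: "a \<in> U"
  show "(\<exists>y\<in>U. e 0 = pair a y) \<or> a = \<zero> \<and> \<not> (\<exists>x\<in>U. \<exists>y\<in>U. e 0 = pair x y) \<longleftrightarrow> a = unpair1 (e 0)"
  proof (cases "\<exists>x\<in>U. \<exists>y\<in>U. e 0 = pair x y")
    case True
    then show ?thesis using a by auto
  next
    case False
    then have "unpair1 (e 0) = \<zero>" unfolding unpair1_def by (rule if_not_P)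
    with False a show ?thesis by auto
  qed
qed

lemma dfun_unpair2: "dfun (\<lambda>e. unpair2 (e 0))"
proof (rule dfunI[where Q = "\<lambda>a e. (\<exists>x\<in>U. e 0 = pair x a) \<or>
    a = \<zero> \<and> \<not> (\<exists>y\<in>U. \<exists>x\<in>U. e 0 = pair x y)"])
  show "dpred (\<lambda>e. (\<exists>x\<in>U. e (Suc 0) = pair x (e 0)) \<or>
      e 0 = \<zero> \<and> \<not> (\<exists>y\<in>U. \<exists>x\<in>U. e (Suc 0) = pair x y))"
    by (intro definable_intros dfun_pair)
next
  fix e :: "nat \<Rightarrow> 'a" assume "range e \<subseteq> U"
  have "unpair2 u \<in> U" for u
  proof (cases "\<exists>y\<in>U. \<exists>x\<in>U. u = pair x y")
    case False
    then show ?thesis unfolding unpair2_def by (subst if_not_P) simp_all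
  qed auto
  then show "unpair2 (e 0) \<in> U" .
next
  fix a and e :: "nat \<Rightarrow> 'a" assume a: "a \<in> U"
  show "(\<exists>x\<in>U. e 0 = pair x a) \<or> a = \<zero> \<and> \<not> (\<exists>y\<in>U. \<exists>x\<in>U. e 0 = pair x y) \<longleftrightarrow> a = unpair2 (e 0)"
  proof (cases "\<exists>y\<in>U. \<exists>x\<in>U. e 0 = pair x y")
    case True
    then show ?thesis using a by auto
  next
    case False
    then have "unpair2 (e 0) = \<zero>" unfolding unpair2_def by (rule if_not_P)
    with False a show ?thesis by auto
  qed
qed

text \<open>The length is not stored: it is a fixed standard number in every use.\<close>

definition encode :: "'a list \<Rightarrow> 'a" where
  "encode xs = foldr pair xs \<zero>"

definition entry :: "nat \<Rightarrow> 'a \<Rightarrow> 'a" where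
  "entry j u = unpair1 ((unpair2 ^^ j) u)"

lemma encode_closed: "set xs \<subseteq> U \<Longrightarrow> encode xs \<in> U"
  by (induction xs) (simp_all add: encode_def)

lemma entry_encode:
  assumes "set xs \<subseteq> U" "j < length xs"
  shows "entry j (encode xs) = xs ! j"
  using assms
proof (induction xs arbitrary: j)
  case (Cons x xs)
  then show ?case
    using encode_closed[of xs]
    by (cases j) (simp_all add: entry_def encode_def funpow_Suc_right del: funpow.simps)
qed simp

lemma map_entry_encode: "set xs \<subseteq> U \<Longrightarrow> map (\<lambda>j. entry j (encode xs)) [0..<length xs] = xs"
  by (intro nth_equalityI) (simp_all add: entry_encode)

lemma dfun_entry: "dfun s \<Longrightarrow> dfun (\<lambda>e. entry j (s e))"
proof -
  have "dfun (\<lambda>e. (unpair2 ^^ j) (e 0))"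
    by (induction j) (simp_all add: dfun_var dfun_subst1[OF dfun_unpair2])
  then have "dfun (\<lambda>e. entry j (e 0))"
    unfolding entry_def by (rule dfun_subst1[OF dfun_unpair1])
  then show "dfun s \<Longrightarrow> dfun (\<lambda>e. entry j (s e))"
    by (rule dfun_subst1)
qed

lemma dfun_encode:
  assumes "dlist F"
  shows "dfun (\<lambda>e. encode (F e))"
proof -
  from assms obtain ts where ts: "\<forall>t\<in>set ts. dfun t"
    "\<And>e. range e \<subseteq> U \<Longrightarrow> F e = map (\<lambda>t. t e) ts"
    unfolding dlist_def by blast
  from ts(1) have "dfun (\<lambda>e. encode (map (\<lambda>t. t e) ts))"
    by (induction ts) (simp_all add: encode_def dfun_arith(1) dfun_pair)
  then show ?thesis by (rule dfun_cong) (simp add: ts(2))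
qed

end

section \<open>Presentations of structures by single elements\<close>

text \<open>Elements of \<open>N\<close> have single codes in \<open>M\<close>. Decoding is total on
  \<open>U\<close>, so a quantifier over \<open>N\<close> becomes one over \<open>U\<close>, and
  \<open>\<gamma> (\<delta> u)\<close> is the canonical code of whatever \<open>u\<close> denotes,
  which makes equality in \<open>N\<close> definable.\<close>

locale presentation = fo_structure L M + N: fo_structure K N
  for L :: "('f, 'r) lang" and M :: "('a, 'f, 'r) struct"
    and K :: "('g, 's) lang" and N :: "('b, 'g, 's) struct" +
  fixes \<gamma> :: "'b \<Rightarrow> 'a" and \<delta> :: "'a \<Rightarrow> 'b"
  assumes code_closed: "y \<in> univ N \<Longrightarrow> \<gamma> y \<in> U"
    and decode_closed: "u \<in> U \<Longrightarrow> \<delta> u \<in> univ N"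
    and decode_code: "y \<in> univ N \<Longrightarrow> \<delta> (\<gamma> y) = y"
    and dfun_code_decode: "dfun (\<lambda>e. \<gamma> (\<delta> (e 0)))"
    and dfun_code_fn: "(f, n) \<in> funs K \<Longrightarrow> dfun (\<lambda>e. \<gamma> (fn N f (map (\<lambda>i. \<delta> (e i)) [0..<n])))"
    and dpred_decode_rel: "(r, n) \<in> rels K \<Longrightarrow> dpred (\<lambda>e. rel N r (map (\<lambda>i. \<delta> (e i)) [0..<n]))"
begin

definition dmap :: "((nat \<Rightarrow> 'a) \<Rightarrow> 'b) \<Rightarrow> bool" where
  "dmap t \<longleftrightarrow> (\<forall>e. range e \<subseteq> U \<longrightarrow> t e \<in> univ N) \<and> dfun (\<lambda>e. \<gamma> (t e))"

lemma dmapD: "dmap t \<Longrightarrow> range e \<subseteq> U \<Longrightarrow> t e \<in> univ N" "dmap t \<Longrightarrow> dfun (\<lambda>e. \<gamma> (t e))"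
  by (simp_all add: dmap_def)

lemma dmap_decode: "dfun s \<Longrightarrow> dmap (\<lambda>e. \<delta> (s e))"
  unfolding dmap_def using dfun_subst1[OF dfun_code_decode] by (simp add: decode_closed dfunD)

lemma dmap_const: "y \<in> univ N \<Longrightarrow> dmap (\<lambda>e. y)"
  by (simp add: dmap_def dfun_const code_closed)

lemma dpred_dmap_eq:
  assumes "dmap s" "dmap t"
  shows "dpred (\<lambda>e. s e = t e)"
proof (rule dpred_cong[OF dpred_eq[OF dmapD(2)[OF assms(1)] dmapD(2)[OF assms(2)]]])
  fix e :: "nat \<Rightarrow> 'a" assume "range e \<subseteq> U"
  then show "\<gamma> (s e) = \<gamma> (t e) \<longleftrightarrow> s e = t e"
    using dmapD(1)[OF assms(1)] dmapD(1)[OF assms(2)] decode_code by metis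
qed

definition code_nth :: "((nat \<Rightarrow> 'a) \<Rightarrow> 'b) list \<Rightarrow> nat \<Rightarrow> (nat \<Rightarrow> 'a) \<Rightarrow> 'a" where
  "code_nth ts i e = (if i < length ts then \<gamma> ((ts ! i) e) else e 0)"

lemma dfun_code_nth: "(\<And>t. t \<in> set ts \<Longrightarrow> dmap t) \<Longrightarrow> dfun (code_nth ts i)"
  unfolding code_nth_def[abs_def] by (cases "i < length ts") (simp_all add: dmapD(2) dfun_var)

lemma decode_code_nth:
  assumes "\<And>t. t \<in> set ts \<Longrightarrow> dmap t" "range e \<subseteq> U"
  shows "map (\<lambda>i. \<delta> (code_nth ts i e)) [0..<length ts] = map (\<lambda>t. t e) ts"
  using assms by (intro nth_equalityI) (simp_all add: code_nth_def decode_code dmapD(1))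

lemma dmap_fn:
  assumes f: "(f, length ts) \<in> funs K" and ts: "\<And>t. t \<in> set ts \<Longrightarrow> dmap t"
  shows "dmap (\<lambda>e. fn N f (map (\<lambda>t. t e) ts))"
  unfolding dmap_def
proof (intro conjI allI impI)
  fix e :: "nat \<Rightarrow> 'a" assume "range e \<subseteq> U"
  then show "fn N f (map (\<lambda>t. t e) ts) \<in> univ N"
    using f ts by (intro N.fn_closed) (auto simp: dmapD(1))
next
  have "dfun (code_nth ts i)" for i
    using ts by (rule dfun_code_nth)
  from dfun_subst[where t = "code_nth ts", OF dfun_code_fn[OF f] this]
  show "dfun (\<lambda>e. \<gamma> (fn N f (map (\<lambda>t. t e) ts)))"
    by (rule dfun_cong) (simp add: decode_code_nth ts)
qed

lemma dpred_rel:
  assumes r: "(r, length ts) \<in> rels K" and ts: "\<And>t. t \<in> set ts \<Longrightarrow> dmap t"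
  shows "dpred (\<lambda>e. rel N r (map (\<lambda>t. t e) ts))"
proof -
  have "dfun (code_nth ts i)" for i
    using ts by (rule dfun_code_nth)
  from dpred_subst[where t = "code_nth ts", OF dpred_decode_rel[OF r] this] show ?thesis
    by (rule dpred_cong) (simp add: decode_code_nth ts)
qed

lemma dmap_val: "tm_in K t \<Longrightarrow> dmap (\<lambda>e. val N (\<lambda>i. \<delta> (e i)) t)"
proof (induction t)
  case (Var i)
  show ?case by (simp add: dmap_decode dfun_var)
next
  case (Fn f ts)
  then have "dmap (\<lambda>e. fn N f (map (\<lambda>t. t e) (map (\<lambda>t e. val N (\<lambda>i. \<delta> (e i)) t) ts)))"
    by (intro dmap_fn) auto
  then show ?case by (simp add: comp_def)
qed

lemma dpred_sat: "fm_in K \<phi> \<Longrightarrow> dpred (\<lambda>e. sat N (\<lambda>i. \<delta> (e i)) \<phi>)"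
proof (induction \<phi>)
  case (Eq s t)
  then show ?case by (simp add: dpred_dmap_eq dmap_val)
next
  case (Rl r ts)
  then have "dpred (\<lambda>e. rel N r (map (\<lambda>t. t e) (map (\<lambda>t e. val N (\<lambda>i. \<delta> (e i)) t) ts)))"
    by (intro dpred_rel) (auto simp: dmap_val)
  then show ?case by (simp add: comp_def)
next
  case (Neg \<phi>)
  then show ?case by (simp add: dpred_not)
next
  case (Conj \<phi> \<psi>)
  then show ?case by (simp add: dpred_conj)
next
  case (Forall \<phi>)
  have "(case_nat (\<delta> (e 0)) (\<lambda>i. \<delta> (e (Suc i)))) = (\<lambda>i. \<delta> (e i))" for e
    by (auto split: nat.split)
  then have "dpred (\<lambda>e. sat N (case_nat (\<delta> (e 0)) (\<lambda>i. \<delta> (e (Suc i)))) \<phi>)"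
    using Forall by simp
  then have "dpred (\<lambda>e. \<forall>a\<in>U. sat N (case_nat (\<delta> a) (\<lambda>i. \<delta> (e i))) \<phi>)"
    by (rule dpred_all)
  then show ?case
  proof (rule dpred_cong)
    fix e :: "nat \<Rightarrow> 'a"
    have "univ N = \<delta> ` U" using code_closed decode_closed decode_code by force
    then show "(\<forall>a\<in>U. sat N (case_nat (\<delta> a) (\<lambda>i. \<delta> (e i))) \<phi>) \<longleftrightarrow>
        sat N (\<lambda>i. \<delta> (e i)) (Forall \<phi>)" by simp
  qed
qed

text \<open>The parameters of \<open>N\<close> become their codes in \<open>M\<close>. This is the
  closure of definability under interpretation.\<close>

lemma dpred_translate:
  assumes "N.dpred Q"
  shows "dpred (\<lambda>e. Q (\<lambda>i. \<delta> (e i)))"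
proof -
  from assms obtain \<phi> q where \<phi>: "fm_in K \<phi>" and q: "range q \<subseteq> univ N"
    and Q: "\<And>e. range e \<subseteq> univ N \<Longrightarrow> Q e \<longleftrightarrow> sat N (mix e q) \<phi>"
    unfolding N.dpred_def by blast
  have "dfun (if even i then (\<lambda>e. e (i div 2)) else (\<lambda>e. \<gamma> (q (i div 2))))" for i
    using q by (simp add: dfun_var dfun_const code_closed range_subsetD)
  from dpred_subst[OF dpred_sat[OF \<phi>] this] show ?thesis
  proof (rule dpred_cong)
    fix e :: "nat \<Rightarrow> 'a" assume e: "range e \<subseteq> U"
    have "(\<lambda>i. \<delta> ((if even i then (\<lambda>e. e (i div 2)) else (\<lambda>e. \<gamma> (q (i div 2)))) e)) =
        mix (\<lambda>i. \<delta> (e i)) q"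
      using q by (auto simp: mix_def decode_code range_subsetD)
    moreover have "range (\<lambda>i. \<delta> (e i)) \<subseteq> univ N"
      using e by (auto intro: decode_closed)
    ultimately show "sat N (\<lambda>i. \<delta> ((if even i then (\<lambda>e. e (i div 2)) else (\<lambda>e. \<gamma> (q (i div 2)))) e)) \<phi>
        \<longleftrightarrow> Q (\<lambda>i. \<delta> (e i))"
      using Q by simp
  qed
qed

lemma dmap_compose:
  assumes f: "N.dfun (\<lambda>e. f (e 0))" and s: "dmap s"
  shows "dmap (\<lambda>e. f (s e))"
proof -
  have f_closed: "f y \<in> univ N" if "y \<in> univ N" for y
    using N.dfunD[OF f, of "\<lambda>_. y"] that by auto
  have eq: "dpred (\<lambda>e. \<delta> (e 0) = f (\<delta> (e 1)))"
    using dpred_translate[of "\<lambda>e. e 0 = f (e 1)"] f by (simp add: N.dfun_def)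
  have "dfun (\<lambda>e. \<gamma> (f (\<delta> (e 0))))"
  \<comment> \<open>The first conjunct selects the canonical code among all elements that decode to
    the value, which makes \<open>a\<close> unique.\<close>
  proof (rule dfunI[where Q = "\<lambda>a e. a = \<gamma> (\<delta> a) \<and> \<delta> a = f (\<delta> (e 0))"])
    show "dpred (\<lambda>e. e 0 = \<gamma> (\<delta> (e 0)) \<and> \<delta> (e 0) = f (\<delta> (e (Suc 0))))"
      using eq by (intro dpred_conj dpred_eq dfun_var dfun_code_decode) simp
  qed (auto simp: code_closed decode_closed f_closed decode_code range_subsetD)
  from dfun_subst1[OF this dmapD(2)[OF s]] have "dfun (\<lambda>e. \<gamma> (f (s e)))"
    by (rule dfun_cong) (simp add: decode_code dmapD(1)[OF s])
  then show ?thesis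
    using f_closed dmapD(1)[OF s] by (simp add: dmap_def)
qed

lemma dmap_subst1: "dmap (\<lambda>e. h (e 0)) \<Longrightarrow> dfun s \<Longrightarrow> dmap (\<lambda>e. h (s e))"
  unfolding dmap_def
proof (elim conjE, intro conjI allI impI)
  fix e :: "nat \<Rightarrow> 'a"
  assume "\<forall>e. range e \<subseteq> U \<longrightarrow> h (e 0) \<in> univ N" "dfun s" "range e \<subseteq> U"
  then show "h (s e) \<in> univ N"
    by (auto dest: spec[of _ "\<lambda>_. s e"] dfunD)
qed (rule dfun_subst1)

end

text \<open>All blocks have the same length \<open>k\<close>, so a concatenation can be cut back
  into blocks in one way only.\<close>

lemma concat_map_inj:
  assumes "concat (map c xs) = concat (map c ys)" "length xs = length ys"
    and "inj_on c V" "set xs \<subseteq> V" "set ys \<subseteq> V" "\<And>y. y \<in> V \<Longrightarrow> length (c y) = k"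
  shows "xs = ys"
proof -
  have "map c xs = map c ys"
  proof (rule concat_injective[OF assms(1)])
    show "\<forall>(x, y)\<in>set (zip (map c xs) (map c ys)). length x = length y"
      using assms(4-6) by (auto simp: set_zip subset_iff)
  qed (simp add: assms(2))
  then show ?thesis
    by (rule map_inj_on) (use assms(3-5) in \<open>auto intro: inj_on_subset\<close>)
qed

context pa_structure
begin

text \<open>Besides the codes, the recovery of the coordinates \<open>c\<close> from them is kept,
  since the final definability claims concern \<open>c\<close>.\<close>

lemma interprets_presentation:
  assumes int: "interprets L M c K N"
  shows "\<exists>\<gamma> \<delta> k. presentation L M K N \<gamma> \<delta> \<and>
    (\<forall>y\<in>univ N. c y \<in> tuples U k \<and> c y = map (\<lambda>j. entry j (\<gamma> y)) [0..<k])"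
proof -
  have N: "is_struct K N" and inj: "inj_on c (univ N)" and univ: "definable L M (c ` univ N)"
    and funs: "\<And>f n. (f, n) \<in> funs K \<Longrightarrow>
      definable L M ((\<lambda>xs. concat (map c xs) @ c (fn N f xs)) ` tuples (univ N) n)"
    and rels: "\<And>r n. (r, n) \<in> rels K \<Longrightarrow>
      definable L M ((\<lambda>xs. concat (map c xs)) ` {xs \<in> tuples (univ N) n. rel N r xs})"
    using int unfolding interprets_def by auto
  interpret N: fo_structure K N by unfold_locales (fact N)
  obtain k where k: "c y \<in> tuples U k" if "y \<in> univ N" for y
    using univ unfolding definable_def by (metis (no_types, lifting) image_eqI mem_Collect_eq)
  obtain y0 where y0: "y0 \<in> univ N" using N.univ_nonempty by blast
  define \<gamma> where "\<gamma> y = encode (c y)" for y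
  define C where "C u = map (\<lambda>j. entry j u) [0..<k]" for u
  have C_code: "C (\<gamma> y) = c y" if "y \<in> univ N" for y
    using k[OF that] map_entry_encode[of "c y"] by (auto simp: C_def \<gamma>_def tuples_def)
  have code_closed: "\<gamma> y \<in> U" if "y \<in> univ N" for y
    using k[OF that] by (simp add: \<gamma>_def encode_closed tuples_def)
  have inj_code: "inj_on \<gamma> (univ N)"
    by (rule inj_onI) (metis C_code inj inj_onD)
  \<comment> \<open>Elements that are not codes decode to the arbitrary \<open>y0\<close>.\<close>
  define \<delta> where "\<delta> u = (if u \<in> \<gamma> ` univ N then inv_into (univ N) \<gamma> u else y0)" for u
  have decode_closed: "\<delta> u \<in> univ N" for u
    using y0 by (auto simp: \<delta>_def inv_into_into)
  have decode_code: "\<delta> (\<gamma> y) = y" if "y \<in> univ N" for y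
    using that inj_code by (simp add: \<delta>_def)
  have code_iff_decode: "a = \<gamma> (\<delta> a) \<and> \<delta> a = y \<longleftrightarrow> a = \<gamma> y" if "y \<in> univ N" for a y
    using decode_code[OF that] by metis
  have dlist_C: "dlist (\<lambda>e. C (s e))" if "dfun s" for s
    unfolding C_def using that by (intro dlist_map dfun_entry)
  \<comment> \<open>Distinct elements may share their first \<open>k\<close> entries, so
    \<open>u\<close> must also equal the encoding of those entries.\<close>
  have code_iff: "u \<in> \<gamma> ` univ N \<longleftrightarrow> C u \<in> c ` univ N \<and> u = encode (C u)" for u
  proof
    assume "u \<in> \<gamma> ` univ N"
    then obtain y where "y \<in> univ N" "u = \<gamma> y" by blast
    then show "C u \<in> c ` univ N \<and> u = encode (C u)"
      using C_code by (auto simp: \<gamma>_def)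
  next
    assume "C u \<in> c ` univ N \<and> u = encode (C u)"
    then obtain y where "y \<in> univ N" "u = encode (c y)" by auto
    then show "u \<in> \<gamma> ` univ N" by (auto simp: \<gamma>_def)
  qed
  have code_decode_dpred: "dpred (\<lambda>e. s e \<in> \<gamma> ` univ N)" if "dfun s" for s
    unfolding code_iff using that
    by (intro dpred_conj dpred_mem_definable[OF univ] dpred_eq dfun_encode dlist_C)
  have code_decode: "\<gamma> (\<delta> u) = (if u \<in> \<gamma> ` univ N then u else \<gamma> y0)" for u
    by (auto simp: \<delta>_def f_inv_into_f)
  have dfun_code_decode: "dfun (\<lambda>e. \<gamma> (\<delta> (e 0)))"
  proof (rule dfunI[where Q = "\<lambda>a e. e 0 \<in> \<gamma> ` univ N \<and> a = e 0 \<or> e 0 \<notin> \<gamma> ` univ N \<and> a = \<gamma> y0"])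
    show "dpred (\<lambda>e. e (Suc 0) \<in> \<gamma> ` univ N \<and> e 0 = e (Suc 0) \<or>
        e (Suc 0) \<notin> \<gamma> ` univ N \<and> e 0 = \<gamma> y0)"
      by (intro definable_intros code_decode_dpred dfun_const code_closed y0)
  qed (use y0 in \<open>auto simp: code_closed code_decode\<close>)
  have dfun_code_decode_subst: "dfun (\<lambda>e. \<gamma> (\<delta> (s e)))" if "dfun s" for s
    using dfun_subst1[OF dfun_code_decode that] .
  have dlist_decode: "dlist (\<lambda>e. c (\<delta> (s e)))" if "dfun s" for s
    using dlist_C[OF dfun_code_decode_subst[OF that]] by (simp add: C_code decode_closed)
  have dlist_concat_decode: "dlist (\<lambda>e. concat (map c (map (\<lambda>i. \<delta> (e i)) is)))" for "is"
    using dlist_concat[of "is" "\<lambda>i e. c (\<delta> (e i))"] by (simp add: dlist_decode dfun_var comp_def)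
  have concat_inj: "xs = ys" if "concat (map c xs) = concat (map c ys)" "length xs = length ys"
    "set xs \<subseteq> univ N" "set ys \<subseteq> univ N" for xs ys
    by (rule concat_map_inj[OF that(1,2) inj that(3,4)]) (use k in \<open>auto simp: tuples_def\<close>)
  have "presentation L M K N \<gamma> \<delta>"
  proof unfold_locales
    fix f n assume f: "(f, n) \<in> funs K"
    let ?X = "(\<lambda>xs. concat (map c xs) @ c (fn N f xs)) ` tuples (univ N) n"
    show "dfun (\<lambda>e. \<gamma> (fn N f (map (\<lambda>i. \<delta> (e i)) [0..<n])))"
    proof (rule dfunI[where Q = "\<lambda>a e. a = \<gamma> (\<delta> a) \<and>
        concat (map c (map (\<lambda>i. \<delta> (e i)) [0..<n])) @ c (\<delta> a) \<in> ?X"])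
      have "dlist (\<lambda>e. concat (map c (map (\<lambda>i. \<delta> (e i)) (map Suc [0..<n]))))"
        by (rule dlist_concat_decode)
      then show "dpred (\<lambda>e. e 0 = \<gamma> (\<delta> (e 0)) \<and>
          concat (map c (map (\<lambda>i. \<delta> (e (Suc i))) [0..<n])) @ c (\<delta> (e 0)) \<in> ?X)"
        by (intro dpred_conj dpred_eq dfun_var dfun_code_decode dpred_mem_definable[OF funs[OF f]]
            dlist_append dlist_decode) (simp add: comp_def)
    next
      fix e :: "nat \<Rightarrow> 'a"
      let ?xs = "map (\<lambda>i. \<delta> (e i)) [0..<n]"
      have xs: "?xs \<in> tuples (univ N) n" using decode_closed by (auto simp: tuples_def)
      have fn_xs: "fn N f xs \<in> univ N" if "xs \<in> tuples (univ N) n" for xs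
        using N.fn_closed[of f xs] f that by (simp add: tuples_def)
      then show "\<gamma> (fn N f ?xs) \<in> U" using code_closed xs by blast
      fix a
      have "concat (map c ?xs) @ c (\<delta> a) \<in> ?X \<longleftrightarrow> \<delta> a = fn N f ?xs"
      proof
        assume "concat (map c ?xs) @ c (\<delta> a) \<in> ?X"
        then obtain ys where ys: "ys \<in> tuples (univ N) n"
          "concat (map c ?xs) @ c (\<delta> a) = concat (map c ys) @ c (fn N f ys)" by blast
        \<comment> \<open>Arguments and value together form one list of \<open>n + 1\<close> blocks,
          so unique decomposition applies to all of them at once.\<close>
        have "?xs @ [\<delta> a] = ys @ [fn N f ys]"
          by (rule concat_inj) (use ys xs fn_xs decode_closed in \<open>auto simp: tuples_def\<close>)
        then show "\<delta> a = fn N f ?xs" by simp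
      next
        assume "\<delta> a = fn N f ?xs"
        then show "concat (map c ?xs) @ c (\<delta> a) \<in> ?X"
          using xs by (metis (no_types, lifting) image_eqI)
      qed
      then show "a = \<gamma> (\<delta> a) \<and> concat (map c ?xs) @ c (\<delta> a) \<in> ?X \<longleftrightarrow> a = \<gamma> (fn N f ?xs)"
        by (rule ssubst) (rule code_iff_decode[OF fn_xs[OF xs]])
    qed
  next
    fix r n assume r: "(r, n) \<in> rels K"
    let ?X = "(\<lambda>xs. concat (map c xs)) ` {xs \<in> tuples (univ N) n. rel N r xs}"
    have "dpred (\<lambda>e. concat (map c (map (\<lambda>i. \<delta> (e i)) [0..<n])) \<in> ?X)"
      by (intro dpred_mem_definable[OF rels[OF r]] dlist_concat_decode)
    then show "dpred (\<lambda>e. rel N r (map (\<lambda>i. \<delta> (e i)) [0..<n]))"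
    proof (rule dpred_cong)
      fix e :: "nat \<Rightarrow> 'a"
      let ?xs = "map (\<lambda>i. \<delta> (e i)) [0..<n]"
      have xs: "?xs \<in> tuples (univ N) n" using decode_closed by (auto simp: tuples_def)
      show "concat (map c ?xs) \<in> ?X \<longleftrightarrow> rel N r ?xs"
      proof
        assume "concat (map c ?xs) \<in> ?X"
        then obtain ys where ys: "ys \<in> tuples (univ N) n" "rel N r ys"
          "concat (map c ?xs) = concat (map c ys)" by blast
        have "?xs = ys"
          by (rule concat_inj) (use ys xs in \<open>auto simp: tuples_def\<close>)
        with ys show "rel N r ?xs" by simp
      qed (use xs in blast)
    qed
  qed (simp_all add: code_closed decode_closed decode_code dfun_code_decode)
  moreover have "\<forall>y\<in>univ N. c y \<in> tuples U k \<and> c y = map (\<lambda>j. entry j (\<gamma> y)) [0..<k]"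
    using k C_code by (simp add: C_def)
  ultimately show ?thesis by blast
qed

end

section \<open>Initial embeddings\<close>

locale pa_presentation = pa_structure L M + N: pa_structure K N + presentation L M K N \<gamma> \<delta>
  for L :: "('f fsym, 'r rsym) lang" and M :: "('a, 'f fsym, 'r rsym) struct"
    and K :: "('f fsym, 'r rsym) lang" and N :: "('b, 'f fsym, 'r rsym) struct"
    and \<gamma> :: "'b \<Rightarrow> 'a" and \<delta> :: "'a \<Rightarrow> 'b"
begin

lemma dmap_arith:
  "dmap s \<Longrightarrow> dmap (\<lambda>e. N.succ (s e))"
  "dmap s \<Longrightarrow> dmap t \<Longrightarrow> dmap (\<lambda>e. N.add (s e) (t e))"
  "dmap s \<Longrightarrow> dmap t \<Longrightarrow> dmap (\<lambda>e. N.mult (s e) (t e))"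
  using dmap_fn[of Succ "[s]"] dmap_fn[of Plus "[s, t]"] dmap_fn[of Times "[s, t]"]
  by (auto simp: N.arith_symbols)

text \<open>The recursion runs in \<open>M\<close> on codes, iterating the successor of
  \<open>N\<close> conjugated by coding, and its result is decoded.\<close>

lemma exists_initial_map:
  "\<exists>h. dmap (\<lambda>e. h (e 0)) \<and> h zero = N.zero \<and> (\<forall>x\<in>U. h (succ x) = N.succ (h x))"
proof -
  have g: "dfun (\<lambda>e. \<gamma> (N.succ (\<delta> (e 0))))"
    by (intro dmapD(2) dmap_arith dmap_decode dfun_var)
  obtain h where h: "dfun (\<lambda>e. h (e 0))" "h zero = \<gamma> N.zero"
    "\<And>x. x \<in> U \<Longrightarrow> h (succ x) = \<gamma> (N.succ (\<delta> (h x)))"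
    using primitive_recursion[OF code_closed[OF N.arith_closed(1)] g] by blast
  have "h x \<in> U" if "x \<in> U" for x
    using dfunD[OF h(1), of "\<lambda>_. x"] that by auto
  then show ?thesis
    using h by (intro exI[of _ "\<lambda>x. \<delta> (h x)"]) (simp add: dmap_decode decode_code decode_closed)
qed

end

locale initial_map = pa_presentation L M K N \<gamma> \<delta>
  for L :: "('f fsym, 'r rsym) lang" and M :: "('a, 'f fsym, 'r rsym) struct"
    and K :: "('f fsym, 'r rsym) lang" and N :: "('b, 'f fsym, 'r rsym) struct"
    and \<gamma> :: "'b \<Rightarrow> 'a" and \<delta> :: "'a \<Rightarrow> 'b" +
  fixes h :: "'a \<Rightarrow> 'b"
  assumes dmap_h: "dmap (\<lambda>e. h (e 0))"
    and h_zero [simp]: "h zero = N.zero"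
    and h_succ [simp]: "x \<in> U \<Longrightarrow> h (succ x) = N.succ (h x)"
begin

lemma h_closed [simp]: "x \<in> U \<Longrightarrow> h x \<in> univ N"
  using dmapD(1)[OF dmap_h, of "\<lambda>_. x"] by auto

lemmas dmap_intros = definable_intros dpred_dmap_eq dmap_arith dmap_subst1[OF dmap_h]

lemma h_add:
  assumes x: "x \<in> U" and "y \<in> U"
  shows "h (add x y) = N.add (h x) (h y)"
  using assms(2)
proof (induction rule: PA_induct)
  case definable
  show ?case
    by (rule dpred_dmap_eq) (intro dmap_intros dfun_const dmap_const x h_closed)+
qed (simp_all add: x)

lemma h_mult:
  assumes x: "x \<in> U" and "y \<in> U"
  shows "h (mult x y) = N.mult (h x) (h y)"
  using assms(2)
proof (induction rule: PA_induct)
  case definable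
  show ?case
    by (rule dpred_dmap_eq) (intro dmap_intros dfun_const dmap_const x h_closed)+
qed (simp_all add: x h_add)

lemma inj_on_h: "inj_on h U"
proof -
  \<comment> \<open>The quantifier over \<open>y\<close> belongs to the induction predicate, because
    the hypothesis is applied to the predecessor of \<open>y\<close>.\<close>
  have "\<forall>y\<in>U. h x = h y \<longrightarrow> x = y" if "x \<in> U" for x
    using that
  proof (induction rule: PA_induct)
    case definable
    show ?case
      by (intro dpred_all dpred_imp dpred_eq dfun_var) (rule dpred_dmap_eq, (intro dmap_intros)+)
  next
    case zero
    have "zero = y" if "y \<in> U" "h zero = h y" for y
      using zero_or_succ[OF that(1)] that by auto
    then show ?case by blast
  next
    case (succ x)
    have "succ x = y" if "y \<in> U" "h (succ x) = h y" for y
      using zero_or_succ[OF that(1)] that succ by auto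
    then show ?case by blast
  qed
  then show ?thesis by (auto intro: inj_onI)
qed

text \<open>Surjectivity also serves the order: \<open>Less\<close> is existential, and a witness in
  \<open>N\<close> has to be pulled back to \<open>U\<close>.\<close>

lemma isomorphism_h:
  assumes surj: "h ` U = univ N"
  shows "isomorphism LA M N h"
proof -
  have less: "rel M Less [x, y] \<longleftrightarrow> rel N Less [h x, h y]" if xy: "x \<in> U" "y \<in> U" for x y
  proof -
    have "(\<exists>z\<in>U. add x (succ z) = y) \<longleftrightarrow> (\<exists>z\<in>U. h (add x (succ z)) = h y)"
      using xy by (intro bex_cong refl inj_on_eq_iff[OF inj_on_h, symmetric]) simp_all
    also have "\<dots> \<longleftrightarrow> (\<exists>z\<in>U. N.add (h x) (N.succ (h z)) = h y)"
      using xy by (simp add: h_add)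
    also have "\<dots> \<longleftrightarrow> (\<exists>w\<in>univ N. N.add (h x) (N.succ w) = h y)"
      unfolding surj[symmetric] by blast
    finally show ?thesis
      using xy by (simp add: Less_iff N.Less_iff)
  qed
  have tuples: "tuples A 0 = {[]}" "tuples A (Suc 0) = {[x] |x. x \<in> A}"
    "tuples A 2 = {[x, y] |x y. x \<in> A \<and> y \<in> A}" for A :: "'a set"
    by (auto simp: tuples_def length_Suc_conv numeral_2_eq_2)
  show ?thesis
    unfolding isomorphism_def
    using surj inj_on_h by (auto simp: LA_def bij_betw_def tuples h_add h_mult less)
qed

end

section \<open>Definability in terms of coordinates\<close>

context presentation
begin

lemma dpred_ball_list: "(\<And>i. i \<in> set is \<Longrightarrow> dpred (P i)) \<Longrightarrow> dpred (\<lambda>e. \<forall>i\<in>set is. P i e)"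
  by (induction "is") (simp_all add: dpred_const dpred_conj)

text \<open>Returns from codes to the tuples demanded by \<open>definable_map\<close>; the
  projections \<open>\<pi>\<close> are abstract since coding of tuples is specific to
  arithmetic.\<close>

lemma definable_map_coordinates:
  assumes h: "dmap (\<lambda>e. h (e 0))"
    and c: "\<And>y. y \<in> univ N \<Longrightarrow> c y = map (\<lambda>j. \<pi> j (\<gamma> y)) [0..<k]"
    and \<pi>: "\<And>j s. dfun s \<Longrightarrow> dfun (\<lambda>e. \<pi> j (s e))"
  shows "definable_map L M self U c h"
  unfolding definable_map_def
proof (rule definableI)
  let ?X = "(\<lambda>x. self x @ c (h x)) ` U"
  have h_closed: "h x \<in> univ N" if "x \<in> U" for x
    using dmapD(1)[OF h, of "\<lambda>_. x"] that by auto
  have \<pi>_closed: "\<pi> j u \<in> U" if "u \<in> U" for j u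
    using dfunD[OF \<pi>[OF dfun_var, of j 0], of "\<lambda>_. u"] that by auto
  show "?X \<subseteq> tuples U (Suc k)"
    using h_closed \<pi>_closed code_closed by (auto simp: c tuples_def self_def)
  have "dpred (\<lambda>e. \<forall>j\<in>set [0..<k]. e (Suc j) = \<pi> j (\<gamma> (h (e 0))))"
    by (intro dpred_ball_list dpred_eq dfun_var \<pi> dmapD(2)[OF h])
  then show "dpred (\<lambda>e. map e [0..<Suc k] \<in> ?X)"
  proof (rule dpred_cong)
    fix e :: "nat \<Rightarrow> 'a" assume "range e \<subseteq> U"
    then have e0: "e 0 \<in> U" by auto
    have "map e [0..<Suc k] = e 0 # map (\<lambda>j. e (Suc j)) [0..<k]"
      by (simp add: map_upt_Suc del: upt_Suc)
    then have "map e [0..<Suc k] \<in> ?X \<longleftrightarrow> map (\<lambda>j. e (Suc j)) [0..<k] = c (h (e 0))"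
      using e0 by (auto simp: self_def)
    then show "(\<forall>j\<in>set [0..<k]. e (Suc j) = \<pi> j (\<gamma> (h (e 0)))) \<longleftrightarrow> map e [0..<Suc k] \<in> ?X"
      using c[OF h_closed[OF e0]] by simp
  qed
qed

end

section \<open>Transport of a structure along a definable bijection\<close>

definition pullback :: "'a set \<Rightarrow> ('a \<Rightarrow> 'b) \<Rightarrow> ('b, 'g, 's) struct \<Rightarrow> ('a, 'g, 's) struct" where
  "pullback A h N = \<lparr>univ = A, fn = (\<lambda>f xs. inv_into A h (fn N f (map h xs))),
     rel = (\<lambda>r xs. rel N r (map h xs))\<rparr>"

lemma pullback_simps [simp]:
  "univ (pullback A h N) = A"
  "fn (pullback A h N) f xs = inv_into A h (fn N f (map h xs))"
  "rel (pullback A h N) r xs \<longleftrightarrow> rel N r (map h xs)"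
  by (simp_all add: pullback_def)

lemma map_tuples: "h ` A \<subseteq> B \<Longrightarrow> xs \<in> tuples A n \<Longrightarrow> map h xs \<in> tuples B n"
  by (auto simp: tuples_def)

lemma isomorphism_pullback:
  assumes N: "is_struct K N" and h: "bij_betw h A (univ N)"
  shows "is_struct K (pullback A h N)" "isomorphism K (pullback A h N) N h"
proof -
  have A: "h ` A = univ N" using h by (simp add: bij_betw_def)
  have fn_closed: "fn N f (map h xs) \<in> univ N" if "(f, n) \<in> funs K" "xs \<in> tuples A n" for f n xs
    using N that map_tuples[of h A "univ N" xs n] A by (auto simp: is_struct_def)
  then show "is_struct K (pullback A h N)"
    unfolding is_struct_def using N A
    by (auto simp: is_struct_def intro!: inv_into_into)
  show "isomorphism K (pullback A h N) N h"
    unfolding isomorphism_def using h fn_closed A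
    by (auto simp: f_inv_into_f)
qed

lemma (in presentation) interprets_pullback:
  assumes h: "dmap (\<lambda>e. h (e 0))" and bij: "bij_betw h U (univ N)"
  shows "interprets L M self K (pullback U h N)"
proof -
  have self: "concat (map self xs) = xs" for xs :: "'a list"
    by (induction xs) (simp_all add: self_def)
  have h_at: "dmap (\<lambda>e. h (e i))" for i
    by (rule dmap_subst1[OF h dfun_var])
  have inj: "inj_on h U" and surj: "h ` U = univ N" using bij by (simp_all add: bij_betw_def)
  have "definable L M (self ` U)"
  proof (rule definableI)
    show "self ` U \<subseteq> tuples U 1" by (auto simp: self_def tuples_def)
    show "dpred (\<lambda>e. map e [0..<1] \<in> self ` U)"
      by (rule dpred_cong[OF dpred_const[of True]]) (auto simp: self_def)
  qed
  moreover have "definable L M ((\<lambda>xs. xs @ [inv_into U h (fn N f (map h xs))]) ` tuples U n)"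
    (is "definable L M ?X") if f: "(f, n) \<in> funs K" for f n
  proof (rule definableI)
    have closed: "fn N f (map h xs) \<in> h ` U" if "xs \<in> tuples U n" for xs
      using N.fn_closed[of f "map h xs"] f that surj by (auto simp: tuples_def)
    then show "?X \<subseteq> tuples U (Suc n)"
      by (auto simp: tuples_def inv_into_into)
    have "dmap (\<lambda>e. fn N f (map (\<lambda>t. t e) (map (\<lambda>i e. h (e i)) [0..<n])))"
      using f h_at by (intro dmap_fn) auto
    then have "dpred (\<lambda>e. h (e n) = fn N f (map (\<lambda>t. t e) (map (\<lambda>i e. h (e i)) [0..<n])))"
      by (rule dpred_dmap_eq[OF h_at])
    then show "dpred (\<lambda>e. map e [0..<Suc n] \<in> ?X)"
    proof (rule dpred_cong)
      fix e :: "nat \<Rightarrow> 'a" assume e: "range e \<subseteq> U"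
      have xs: "map e [0..<n] \<in> tuples U n" and en: "e n \<in> U" using e by (auto simp: tuples_def)
      have "map e [0..<Suc n] \<in> ?X \<longleftrightarrow> e n = inv_into U h (fn N f (map h (map e [0..<n])))"
        using xs by auto
      \<comment> \<open>The inverse of \<open>h\<close> is eliminated by applying \<open>h\<close>
        to both sides, leaving an equation between definable maps into \<open>N\<close>.\<close>
      also have "\<dots> \<longleftrightarrow> h (e n) = fn N f (map h (map e [0..<n]))"
        using closed[OF xs] en inj by (metis f_inv_into_f inv_into_f_f)
      finally show "h (e n) = fn N f (map (\<lambda>t. t e) (map (\<lambda>i e. h (e i)) [0..<n])) \<longleftrightarrow>
          map e [0..<Suc n] \<in> ?X"
        by (simp add: comp_def del: upt_Suc)
    qed
  qed
  moreover have "definable L M {xs \<in> tuples U n. rel N r (map h xs)}" if r: "(r, n) \<in> rels K" for r n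
  proof (rule definableI)
    have "dpred (\<lambda>e. rel N r (map (\<lambda>t. t e) (map (\<lambda>i e. h (e i)) [0..<n])))"
      using r h_at by (intro dpred_rel) auto
    then show "dpred (\<lambda>e. map e [0..<n] \<in> {xs \<in> tuples U n. rel N r (map h xs)})"
      by (rule dpred_cong) (auto simp: comp_def tuples_def)
  qed blast
  ultimately show ?thesis
    unfolding interprets_def
    using is_struct isomorphism_pullback(1)[OF N.is_struct bij]
    by (auto simp: self self_def[of "inv_into _ _ _"]) (auto simp: self_def inj_on_def)
qed

text \<open>Only the reducts to \<open>L\<close> matter, so isomorphisms pass freely between the
  models and their expansions.\<close>

lemma isomorphism_expansion:
  assumes M: "expansion L M L' M'" and N: "expansion L N L'' N'"
  shows "isomorphism L M' N' h \<longleftrightarrow> isomorphism L M N h"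
proof (cases "bij_betw h (univ M) (univ N)")
  case True
  then have "map h xs \<in> tuples (univ N) n" if "xs \<in> tuples (univ M) n" for xs n
    using that map_tuples[of h "univ M" "univ N" xs n] by (simp add: bij_betw_def)
  then show ?thesis
    using M N unfolding isomorphism_def expansion_def by fastforce
qed (use M N in \<open>simp add: isomorphism_def expansion_def\<close>)

lemma expansion_pullback:
  assumes M: "is_struct L M" and N: "is_struct K N" and L: "sublang L K"
    and h: "isomorphism L M N h"
  shows "expansion L M K (pullback (univ M) h N)"
proof -
  have bij: "bij_betw h (univ M) (univ N)"
    and fn: "\<And>f n xs. (f, n) \<in> funs L \<Longrightarrow> xs \<in> tuples (univ M) n \<Longrightarrow> fn N f (map h xs) = h (fn M f xs)"
    and rel: "\<And>r n xs. (r, n) \<in> rels L \<Longrightarrow> xs \<in> tuples (univ M) n \<Longrightarrow> rel N r (map h xs) = rel M r xs"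
    using h by (fastforce simp: isomorphism_def)+
  have "fn M f xs \<in> univ M" if "(f, n) \<in> funs L" "xs \<in> tuples (univ M) n" for f n xs
    using M that by (auto simp: is_struct_def)
  then show ?thesis
    unfolding expansion_def using isomorphism_pullback(1)[OF N bij] M L bij
    by (auto simp: fn rel bij_betw_def)
qed

theorem theorem5p4:
  fixes L1 L2 L3 :: "('f fsym, 'r rsym) lang"
    and M1 M1p :: "('a, 'f fsym, 'r rsym) struct"
    and M2 M2p :: "('b, 'f fsym, 'r rsym) struct"
    and M3 M3p :: "('c, 'f fsym, 'r rsym) struct"
    and c :: "'b \<Rightarrow> 'a list" and d :: "'c \<Rightarrow> 'b list" and i0 :: "'a \<Rightarrow> 'c"
  assumes "models LA M1 (PA LA)" and "models LA M2 (PA LA)" and "models LA M3 (PA LA)"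
    and "expansion LA M1 L1 M1p" and "expansion LA M2 L2 M2p" and "expansion LA M3 L3 M3p"
    and "models L1 M1p (PA L1)" and "models L2 M2p (PA L2)" and "models L3 M3p (PA L3)"
    and "interprets L1 M1p c L2 M2p" and "interprets L2 M2p d L3 M3p"
    and "isomorphism LA M1 M3 i0"
    and "definable_map L1 M1p self (univ M1) (compose_coords c d) i0"
  shows "(\<exists>i. isomorphism LA M1 M2 i \<and> definable_map L1 M1p self (univ M1) c i) \<and>
    (\<exists>N j. omega_interpretable L1 M1p L2 N \<and> isomorphism L2 N M2p j \<and>
       definable_map L1 M1p self (univ N) c j)"
proof -
  interpret M1: pa_structure L1 M1p
    using assms(4,7) by unfold_locales (auto simp: expansion_def)
  interpret M2: pa_structure L2 M2p
    using assms(5,8) by unfold_locales (auto simp: expansion_def)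
  interpret M3: pa_structure L3 M3p
    using assms(6,9) by unfold_locales (auto simp: expansion_def)
  have univ: "univ M1p = univ M1"
    using assms(4) by (simp add: expansion_def)
  obtain \<gamma>1 \<delta>1 k1 where P1: "presentation L1 M1p L2 M2p \<gamma>1 \<delta>1"
    and c: "\<And>y. y \<in> univ M2p \<Longrightarrow> c y \<in> tuples (univ M1p) k1"
      "\<And>y. y \<in> univ M2p \<Longrightarrow> c y = map (\<lambda>j. M1.entry j (\<gamma>1 y)) [0..<k1]"
    using M1.interprets_presentation[OF assms(10)] by blast
  obtain \<gamma>2 \<delta>2 k2 where P2: "presentation L2 M2p L3 M3p \<gamma>2 \<delta>2"
    and d: "\<And>y. y \<in> univ M3p \<Longrightarrow> d y \<in> tuples (univ M2p) k2"
      "\<And>y. y \<in> univ M3p \<Longrightarrow> d y = map (\<lambda>j. M2.entry j (\<gamma>2 y)) [0..<k2]"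
    using M2.interprets_presentation[OF assms(11)] by blast
  interpret P1: pa_presentation L1 M1p L2 M2p \<gamma>1 \<delta>1
    by (intro pa_presentation.intro P1 M1.pa_structure_axioms M2.pa_structure_axioms)
  interpret P2: pa_presentation L2 M2p L3 M3p \<gamma>2 \<delta>2
    by (intro pa_presentation.intro P2 M2.pa_structure_axioms M3.pa_structure_axioms)
  obtain h1 where h1: "P1.dmap (\<lambda>e. h1 (e 0))" "h1 M1.zero = M2.zero"
    "\<forall>x\<in>univ M1p. h1 (M1.succ x) = M2.succ (h1 x)"
    using P1.exists_initial_map by blast
  interpret I1: initial_map L1 M1p L2 M2p \<gamma>1 \<delta>1 h1
    by unfold_locales (use h1 in simp_all)
  obtain h2 where h2: "P2.dmap (\<lambda>e. h2 (e 0))" "h2 M2.zero = M3.zero"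
    "\<forall>x\<in>univ M2p. h2 (M2.succ x) = M3.succ (h2 x)"
    using P2.exists_initial_map by blast
  interpret I2: initial_map L2 M2p L3 M3p \<gamma>2 \<delta>2 h2
    by unfold_locales (use h2 in simp_all)

  have "isomorphism LA M1p M3p i0"
    using isomorphism_expansion[OF assms(4,6)] assms(12) by simp
  then have i0_bij: "bij_betw i0 (univ M1p) (univ M3p)" and i0_zero: "i0 M1.zero = M3.zero"
    and i0_succ: "\<And>x. x \<in> univ M1p \<Longrightarrow> i0 (M1.succ x) = M3.succ (i0 x)"
    by (auto simp: isomorphism_def LA_def tuples_def)
  have i0_closed: "i0 x \<in> univ M3p" if "x \<in> univ M1p" for x
    using i0_bij that by (auto simp: bij_betw_def)

  let ?X = "(\<lambda>x. self x @ compose_coords c d (i0 x)) ` univ M1p"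
  \<comment> \<open>The map \<open>i0\<close> is definable only through composed coordinates, so
    these must determine elements: the blocks of \<open>c\<close> separate the tuples of
    \<open>d\<close>, and \<open>d\<close> separates points.\<close>
  have coords_inj: "y = y'"
    if "compose_coords c d y = compose_coords c d y'" "y \<in> univ M3p" "y' \<in> univ M3p" for y y'
  proof -
    have "d y = d y'"
      by (rule concat_map_inj[where c = c and V = "univ M2p" and k = k1])
        (use that c d assms(10) in \<open>auto simp: compose_coords_def tuples_def interprets_def\<close>)
    then show ?thesis
      using assms(11) that(2,3) by (auto simp: interprets_def dest: inj_onD)
  qed
  have in_X: "self x @ compose_coords c d y \<in> ?X \<longleftrightarrow> y = i0 x"
    if "x \<in> univ M1p" "y \<in> univ M3p" for x y
    using that i0_closed coords_inj by (auto simp: self_def)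
  \<comment> \<open>Each coordinate of \<open>h2 y\<close> is a definable function inside
    \<open>M2p\<close>, and \<open>dmap_compose\<close> transfers it to \<open>M1p\<close>; this
    avoids a separate presentation of \<open>M3p\<close> in \<open>M1p\<close>.\<close>
  have "M1.dfun (\<lambda>e. \<gamma>1 (M2.entry j (\<gamma>2 (h2 (h1 (e 0))))))" for j
    by (rule P1.dmapD(2)[OF P1.dmap_compose[OF M2.dfun_entry[OF P2.dmapD(2)[OF I2.dmap_h]] I1.dmap_h]])
  then have "M1.dlist (\<lambda>e. self (e 0) @ concat (map (\<lambda>j.
      map (\<lambda>l. M1.entry l (\<gamma>1 (M2.entry j (\<gamma>2 (h2 (h1 (e 0))))))) [0..<k1]) [0..<k2]))"
    unfolding self_def
    by (intro M1.dlist_append M1.dlist_singleton M1.dfun_var M1.dlist_concat M1.dlist_map M1.dfun_entry)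
  then have "M1.dlist (\<lambda>e. self (e 0) @ compose_coords c d (h2 (h1 (e 0))))"
  proof (rule M1.dlist_cong)
    fix e :: "nat \<Rightarrow> 'a" assume "range e \<subseteq> univ M1p"
    then have y: "h2 (h1 (e 0)) \<in> univ M3p" (is "?y \<in> _") by (simp add: image_subset_iff)
    then have "M2.entry j (\<gamma>2 ?y) \<in> univ M2p" if "j < k2" for j
      using d[OF y] that by (auto simp: tuples_def image_subset_iff)
    then have "map (\<lambda>l. M1.entry l (\<gamma>1 (M2.entry j (\<gamma>2 ?y)))) [0..<k1] = c (M2.entry j (\<gamma>2 ?y))"
      if "j < k2" for j
      using c(2) that by simp
    then show "self (e 0) @ concat (map (\<lambda>j. map (\<lambda>l. M1.entry l (\<gamma>1 (M2.entry j (\<gamma>2 ?y)))) [0..<k1]) [0..<k2])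
      = self (e 0) @ compose_coords c d ?y"
      by (auto simp: compose_coords_def d(2)[OF y] intro!: arg_cong[where f = concat])
  qed
  moreover have "definable L1 M1p ?X"
    using assms(13) by (simp add: definable_map_def univ)
  ultimately have "M1.dpred (\<lambda>e. self (e 0) @ compose_coords c d (h2 (h1 (e 0))) \<in> ?X)"
    by (intro M1.dpred_mem_definable)
  \<comment> \<open>Substituting the definable coordinates of \<open>h2 (h1 x)\<close> into the
    definable graph of \<open>i0\<close> turns the equation itself into an induction formula for
    \<open>M1p\<close>.\<close>
  then have D: "M1.dpred (\<lambda>e. h2 (h1 (e 0)) = i0 (e 0))"
    by (rule M1.dpred_cong) (rule in_X, simp_all add: image_subset_iff)
  have comp: "h2 (h1 x) = i0 x" if "x \<in> univ M1p" for x
    using that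
    by (induction rule: M1.PA_induct) (rule D, simp_all add: i0_zero i0_succ)

  have surj: "h1 ` univ M1p = univ M2p"
  proof (intro equalityI subsetI)
    fix y assume y: "y \<in> univ M2p"
    then have "h2 y \<in> i0 ` univ M1p" using i0_bij by (simp add: bij_betw_def)
    then obtain x where x: "x \<in> univ M1p" "h2 y = h2 (h1 x)" using comp by auto
    then have "y = h1 x" using y inj_onD[OF I2.inj_on_h] by simp
    with x(1) show "y \<in> h1 ` univ M1p" by simp
  qed auto
  then have bij: "bij_betw h1 (univ M1p) (univ M2p)"
    using I1.inj_on_h by (simp add: bij_betw_def)
  have iso: "isomorphism LA M1p M2p h1"
    using surj by (rule I1.isomorphism_h)
  have def_h1: "definable_map L1 M1p self (univ M1p) c h1"
    by (rule P1.definable_map_coordinates[where \<pi> = M1.entry, OF I1.dmap_h c(2) M1.dfun_entry])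

  \<comment> \<open>The required copy of \<open>M2p\<close> lives on the universe of
    \<open>M1p\<close>; \<open>h1\<close> serves both as its isomorphism and as the definable
    map.\<close>
  let ?N = "pullback (univ M1p) h1 M2p"
  have "is_struct LA M1p"
    using M1.is_struct M1.LA_sublang by (auto simp: is_struct_def sublang_def)
  then have "omega_interpretable L1 M1p L2 ?N"
    unfolding omega_interpretable_def
    using P1.interprets_pullback[OF I1.dmap_h bij] expansion_pullback[OF _ M2.is_struct M2.LA_sublang iso]
    by simp
  moreover have "isomorphism L2 ?N M2p h1"
    by (rule isomorphism_pullback(2)[OF M2.is_struct bij])
  moreover have "isomorphism LA M1 M2 h1"
    using isomorphism_expansion[OF assms(4,5)] iso by simp
  ultimately show ?thesis
    using def_h1 univ pullback_simps(1) by metis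
qed

end
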